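(* Fix $\lambda\in[0,1)$, $p\in[0,1]$ and $T>0$. Consider the sequence of $N$-station systems, $N\ge1$, with (possibly random) initial states $\mathbf{V}^N(0)\in\overline{\mathcal{V}}^\infty$. If for some $\mathbf{v}^0\in\overline{\mathcal{V}}^\infty$ we have $\lim_{N\to\infty}\mathbb{P}(\|\mathbf{V}^N(0)-\mathbf{v}^0\|_w>\gamma)=0$ for all $\gamma>0$, then $$\lim_{N\to\infty}\mathbb{P}\Big(\sup_{t\in[0,T]}\|\mathbf{V}^N(t)-\mathbf{v}(\mathbf{v}^0,t)\|_w>\gamma\Big)=0\quad\text{for all }\gamma>0,$$ where $\mathbf{v}(\mathbf{v}^0,\cdot)$ is the unique solution to the fluid model with initial condition $\mathbf{v}^0$.
   Context: The $N$-station system: station $n\in\{1,\dots,N\}$ has queue length $Q_n(t)\in\mathbb{Z}_+$, initially finite. Tasks arrive to each station according to independent Poisson processes of rate $\lambda$. Each station has an independent Poisson clock of rate $1-p$ ("local service tokens"): at a tick, if $Q_n>0$ one task leaves station $n$, otherwise nothing happens. An independent central Poisson clock of rate $Np$ ("central service tokens"): at a tick, if $\sum_nQ_n>0$ one task leaves a station chosen uniformly at random among the stations with a longest queue, otherwise nothing happens. Let $\mathbf{S}^N_i(t)=\frac1N\sum_{n=1}^N\mathbb{I}\{Q_n(t)\ge i\}$ and $\mathbf{V}^N_i(t)=\sum_{j\ge i}\mathbf{S}^N_j(t)$, $i\ge0$. Sets: $\mathcal{S}=\{\mathbf{s}\in[0,1]^{\mathbb{Z}_+}:1=\mathbf{s}_0\ge\mathbf{s}_1\ge\cdots\ge0\}$,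 $\overline{\mathcal{S}}^\infty=\{\mathbf{s}\in\mathcal{S}:\sum_{i\ge1}\mathbf{s}_i<\infty\}$, $\overline{\mathcal{V}}^\infty=\{\mathbf{v}:\mathbf{v}_i=\sum_{j\ge i}\mathbf{s}_j\ \forall i,\text{ for some }\mathbf{s}\in\overline{\mathcal{S}}^\infty\}$; $\|\mathbf{x}\|_w^2=\sum_{i\ge0}2^{-i}\mathbf{x}_i^2$. Fluid model: $g_i(\mathbf{v})=p$ if $\mathbf{v}_i>0$, $=\min\{\lambda\mathbf{v}_{i-1},p\}$ if $\mathbf{v}_i=0<\mathbf{v}_{i-1}$, $=0$ if $\mathbf{v}_i=\mathbf{v}_{i-1}=0$. A solution with initial condition $\mathbf{v}^0$ is $\mathbf{v}:[0,\infty)\to\overline{\mathcal{V}}^\infty$ with (0) all coordinates $L$-Lipschitz for a common $L$; (1) $\mathbf{v}(0)=\mathbf{v}^0$; (2) for all $t$, $\mathbf{v}_0-\mathbf{v}_1=1$ and $1\ge\mathbf{v}_i-\mathbf{v}_{i+1}\ge\mathbf{v}_{i+1}-\mathbf{v}_{i+2}\ge0$, $i\ge0$; (3) for a.e. $t$ and all $i\ge1$, $\dot{\mathbf{v}}_i=\lambda(\mathbf{v}_{i-1}-\mathbf{v}_i)-(1-p)(\mathbf{v}_i-\mathbf{v}_{i+1})-g_i(\mathbf{v})$. It exists and is unique for every $\mathbf{v}^0\in\overline{\mathcal{V}}^\infty$. *)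

theory Defs
  imports "HOL-Probability.Probability"
begin

text \<open>Station n (0-based, n < N) has queue length q ! n; a state is a list of length N.
 Events of the uniformized chain: an arrival at station n, a local service token at
 station n, or a central service token carrying a uniform tie-breaking selector j.\<close>

datatype event = Arr nat | Loc nat | Cen nat

definition longest :: "nat \<Rightarrow> nat list \<Rightarrow> nat list" where
  "longest N q = sorted_list_of_set {n. n < N \<and> q ! n = Max ((\<lambda>m. q ! m) ` {..<N})}"

fun step :: "nat \<Rightarrow> event \<Rightarrow> nat list \<Rightarrow> nat list" where
  "step N (Arr n) q = q[n := q ! n + 1]"
| "step N (Loc n) q = q[n := q ! n - 1]"
| "step N (Cen j) q =
     (let m = Max ((\<lambda>k. q ! k) ` {..<N}); L = longest N q in
      if m = 0 then q else q[L ! (j mod length L) := m - 1])"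

text \<open>Event distribution: total event rate is N(lambda+1); an event is an arrival
 (to a uniform station) w.p. lambda/(lambda+1), otherwise a local token (at a uniform
 station) w.p. 1-p or a central token w.p. p.  The central selector j is uniform on
 {..< N!}, so j mod k is uniform on {..<k} for every k \<le> N, i.e. the served station is
 uniform among the longest queues.\<close>

definition ev_pmf :: "real \<Rightarrow> real \<Rightarrow> nat \<Rightarrow> event pmf" where
  "ev_pmf lam p N =
     bernoulli_pmf (lam / (lam + 1)) \<bind> (\<lambda>a.
       if a then map_pmf Arr (pmf_of_set {..<N})
       else bernoulli_pmf (1 - p) \<bind> (\<lambda>l.
         if l then map_pmf Loc (pmf_of_set {..<N})
         else map_pmf Cen (pmf_of_set {..<fact N})))"

definition drive :: "real \<Rightarrow> real \<Rightarrow> nat \<Rightarrow> (real \<times> event) stream measure" where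
  "drive lam p N = stream_space
     (density lborel (exponential_density (real N * (lam + 1))) \<Otimes>\<^sub>M measure_pmf (ev_pmf lam p N))"

definition sysM :: "real \<Rightarrow> real \<Rightarrow> nat \<Rightarrow> nat list pmf \<Rightarrow> (nat list \<times> (real \<times> event) stream) measure" where
  "sysM lam p N \<mu> = measure_pmf \<mu> \<Otimes>\<^sub>M drive lam p N"

definition njumps :: "(real \<times> event) stream \<Rightarrow> real \<Rightarrow> nat" where
  "njumps \<omega> t = card {k. 0 < k \<and> (\<Sum>i<k. fst (\<omega> !! i)) \<le> t}"

definition run :: "nat \<Rightarrow> nat list \<Rightarrow> (real \<times> event) stream \<Rightarrow> nat \<Rightarrow> nat list" where
  "run N q0 \<omega> k = foldl (\<lambda>q e. step N e q) q0 (map snd (stake k \<omega>))"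

definition Qt :: "nat \<Rightarrow> nat list \<Rightarrow> (real \<times> event) stream \<Rightarrow> real \<Rightarrow> nat list" where
  "Qt N q0 \<omega> t = run N q0 \<omega> (njumps \<omega> t)"

definition Sfrac :: "nat \<Rightarrow> nat list \<Rightarrow> nat \<Rightarrow> real" where
  "Sfrac N q i = real (card {n. n < N \<and> q ! n \<ge> i}) / real N"

definition Vvec :: "nat \<Rightarrow> nat list \<Rightarrow> nat \<Rightarrow> real" where
  "Vvec N q i = (\<Sum>j. Sfrac N q (i + j))"

definition wnorm :: "(nat \<Rightarrow> real) \<Rightarrow> real" where
  "wnorm x = sqrt (\<Sum>i. (1/2) ^ i * (x i)\<^sup>2)"

definition Sbar :: "(nat \<Rightarrow> real) set" where
  "Sbar = {s. s 0 = 1 \<and> (\<forall>i. 0 \<le> s i \<and> s i \<le> 1 \<and> s (Suc i) \<le> s i)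
              \<and> summable (\<lambda>i. s (Suc i))}"

definition Vbar :: "(nat \<Rightarrow> real) set" where
  "Vbar = {v. \<exists>s\<in>Sbar. \<forall>i. v i = (\<Sum>j. s (i + j))}"

definition gfl :: "real \<Rightarrow> real \<Rightarrow> (nat \<Rightarrow> real) \<Rightarrow> nat \<Rightarrow> real" where
  "gfl lam p v i =
     (if v i > 0 then p
      else if v i = 0 \<and> v (i - 1) > 0 then min (lam * v (i - 1)) p
      else 0)"

definition fluid_solution :: "real \<Rightarrow> real \<Rightarrow> (nat \<Rightarrow> real) \<Rightarrow> (real \<Rightarrow> nat \<Rightarrow> real) \<Rightarrow> bool" where
  "fluid_solution lam p v0 v \<longleftrightarrow>
     (\<forall>t\<ge>0. v t \<in> Vbar)
   \<and> (\<exists>L. \<forall>i. L-lipschitz_on {0..} (\<lambda>t. v t i))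
   \<and> v 0 = v0
   \<and> (\<forall>t\<ge>0. v t 0 - v t 1 = 1 \<and>
        (\<forall>i. 1 \<ge> v t i - v t (i + 1) \<and>
             v t i - v t (i + 1) \<ge> v t (i + 1) - v t (i + 2) \<and>
             v t (i + 1) - v t (i + 2) \<ge> 0))
   \<and> (AE t in lborel. 0 < t \<longrightarrow>
        (\<forall>i\<ge>1. ((\<lambda>s. v s i) has_real_derivative
            (lam * (v t (i - 1) - v t i) - (1 - p) * (v t i - v t (i + 1)) - gfl lam p (v t) i))
          (at t)))"

end

theory Submission
  imports Defs
begin

text \<open>The Lyapunov function is \<open>exp (-15 t)\<close> times the squared weighted distance between the
 state of the N-station system at time t and the fluid path at time t. The term for the
 central server is monotone decreasing in each coordinate, also across the discontinuity at 0,
 so the drift of the chain minus the velocity of the fluid path is one-sided Lipschitz in the weighted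
 norm; hence one step of the jump chain increases the Lyapunov function on average by at most
 \<open>2 / N^2\<close>. Adding a multiple of \<open>exp (-t) / N\<close> turns it into a supermartingale before time T,
 and the maximal inequality for this supermartingale, proved by induction over the
 number of steps, bounds the probability of ever leaving a neighbourhood of the fluid path.
 This uses no uniqueness or compactness.\<close>

text \<open>While the chain waits for its next event the fluid path keeps moving, so a single step
  mixes deterministic motion with a random jump. No generator is set up for this: averaging over the
  exponential waiting time reduces to the differential inequality \<open>psi' <= r psi - r k\<close>
  off a null set, where \<open>psi\<close> is the value just before an event after delay u and
  \<open>k\<close> the mean value just after it. The discount rate 15 comes from the weights: the
  drift in coordinate j is controlled by the squared differences at j - 1 and j + 1, and shifting an
  index costs a bounded factor under geometric weights.

  The maximal inequality is a first-event recursion on the driving stream instead of a stopping-time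
  argument. The first has probability of order 1/N^2 per event, like the error of a step, and is
  absorbed by the same compensator. The second vanishes as the number of allowed events tends to
  infinity for fixed N.\<close>

section \<open>Lipschitz functions, exponential averages and weighted sums\<close>

text \<open>The Lipschitz image of the exceptional set is null, so some level y between the end values
 is attained only outside it; at the last point of that level the tilted function h both decreases
 and stays above y to the right.\<close>

lemma ae_nonpos_deriv_nonincreasing:
  fixes g :: "real \<Rightarrow> real"
  assumes "a \<le> b" and cont: "continuous_on {a..b} g" and Z: "negligible Z"
    and lip: "\<And>x y. x \<in> {a..b} \<Longrightarrow> y \<in> {a..b} \<Longrightarrow> \<bar>g y - g x\<bar> \<le> B * \<bar>y - x\<bar>"
    and der: "\<And>x. a < x \<Longrightarrow> x < b \<Longrightarrow> x \<notin> Z \<Longrightarrow> \<exists>D\<le>0. (g has_real_derivative D) (at x)"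
  shows "g b \<le> g a"
proof (rule ccontr)
  assume "\<not> g b \<le> g a"
  then have gab: "g a < g b" by simp
  with \<open>a \<le> b\<close> have ab: "a < b" by (cases "a = b") auto
  \<comment> \<open>Half the mean slope of \<open>g\<close>: the tilted \<open>h\<close> still rises
    from a to b, while its derivative off \<open>Z\<close> becomes strictly negative.\<close>
  define \<epsilon> where "\<epsilon> = (g b - g a) / (2 * (b - a))"
  have \<epsilon>: "\<epsilon> > 0" using gab ab by (simp add: \<epsilon>_def)
  define h where "h x = g x - \<epsilon> * (x - a)" for x
  have ha: "h a = g a" by (simp add: h_def)
  have "\<epsilon> * (b - a) = (g b - g a) / 2" using ab unfolding \<epsilon>_def by (simp add: divide_simps)
  then have hb: "h b > h a" using gab by (simp add: h_def)
  have conth: "continuous_on {a..b} h" unfolding h_def by (intro continuous_intros cont)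
  have negl: "negligible (h ` (Z \<inter> {a..b}))"
  proof (rule negligible_locally_Lipschitz_image)
    show "negligible (Z \<inter> {a..b})" using Z by (simp add: negligible_Int)
    fix x assume x: "x \<in> Z \<inter> {a..b}"
    have "norm (h y - h x) \<le> (B + \<epsilon>) * norm (y - x)" if "y \<in> Z \<inter> {a..b}" for y
    proof -
      have "h y - h x = (g y - g x) - \<epsilon> * (y - x)" by (simp add: h_def algebra_simps)
      then have "\<bar>h y - h x\<bar> \<le> \<bar>g y - g x\<bar> + \<bar>\<epsilon> * (y - x)\<bar>" by linarith
      moreover have "\<bar>\<epsilon> * (y - x)\<bar> = \<epsilon> * \<bar>y - x\<bar>" using \<epsilon> by (simp add: abs_mult)
      ultimately show ?thesis using lip[of x y] x that by (simp add: algebra_simps)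
    qed
    then show "\<exists>T B. open T \<and> x \<in> T \<and> (\<forall>y\<in>(Z \<inter> {a..b}) \<inter> T. norm (h y - h x) \<le> B * norm (y - x))"
      by (intro exI[of _ UNIV] exI[of _ "B + \<epsilon>"]) auto
  qed simp
  have "\<not> {h a<..<h b} \<subseteq> h ` (Z \<inter> {a..b})"
  proof
    assume "{h a<..<h b} \<subseteq> h ` (Z \<inter> {a..b})"
    then have "negligible {h a<..<h b}" using negl negligible_subset by blast
    moreover have "\<not> negligible {h a<..<h b}"
      using hb by (intro open_not_negligible) auto
    ultimately show False by simp
  qed
  then obtain y where y: "h a < y" "y < h b" "y \<notin> h ` (Z \<inter> {a..b})"
    by (meson greaterThanLessThan_iff subsetI)
  define S where "S = {x \<in> {a..b}. h x = y}"
  have "closed S" unfolding S_def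
    using continuous_closed_preimage_constant[OF conth] by simp
  moreover have "S \<noteq> {}"
    using IVT'[of h a y b] y ab conth by (auto simp: S_def)
  moreover have bdd: "bdd_above S" by (auto simp: S_def bdd_above_def)
  ultimately have xS: "Sup S \<in> S" by (intro closed_contains_Sup)
  define x where "x = Sup S"
  have x: "a \<le> x" "x \<le> b" "h x = y" using xS by (auto simp: S_def x_def)
  then have "x \<noteq> a" "x \<noteq> b" using y by auto
  then have xab: "a < x" "x < b" using x by auto
  have "x \<notin> Z" using y x by auto
  then obtain D where D: "D \<le> 0" "(g has_real_derivative D) (at x)" using der xab by blast
  have "(h has_real_derivative (D - \<epsilon>)) (at x)"
    unfolding h_def by (auto intro!: derivative_eq_intros D)
  then obtain d where d: "d > 0" "\<And>e. 0 < e \<Longrightarrow> e < d \<Longrightarrow> h (x + e) < h x"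
    using DERIV_neg_dec_right[of h "D - \<epsilon>" x] D \<epsilon> by auto
  define e where "e = min (d / 2) ((b - x) / 2)"
  have e: "0 < e" "e < d" "x + e < b" using d xab by (auto simp: e_def min_def field_simps)
  have "h (x + e) \<le> y" "y \<le> h b" using d(2)[of e] e x y by auto
  moreover have "continuous_on {x+e..b} h"
    using conth by (rule continuous_on_subset) (use e x in auto)
  ultimately obtain z where "x + e \<le> z" "z \<le> b" "h z = y"
    using IVT'[of h "x + e" y b] e by auto
  then have "z \<in> S" using e xab by (auto simp: S_def)
  then have "z \<le> x" unfolding x_def using bdd by (rule cSup_upper)
  with \<open>x + e \<le> z\<close> e show False by simp
qed

lemma lipschitz_mult_bounded:
  fixes f g :: "real \<Rightarrow> real"
  assumes "\<And>x. x \<in> S \<Longrightarrow> \<bar>f x\<bar> \<le> F" "\<And>x. x \<in> S \<Longrightarrow> \<bar>g x\<bar> \<le> G"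
    and "\<And>x y. x \<in> S \<Longrightarrow> y \<in> S \<Longrightarrow> \<bar>f y - f x\<bar> \<le> A * \<bar>y - x\<bar>"
    and "\<And>x y. x \<in> S \<Longrightarrow> y \<in> S \<Longrightarrow> \<bar>g y - g x\<bar> \<le> B * \<bar>y - x\<bar>"
    and "x \<in> S" "y \<in> S"
  shows "\<bar>f y * g y - f x * g x\<bar> \<le> (F * B + A * G) * \<bar>y - x\<bar>"
proof -
  have "f y * g y - f x * g x = f y * (g y - g x) + (f y - f x) * g x" by (simp add: algebra_simps)
  also have "\<bar>\<dots>\<bar> \<le> \<bar>f y\<bar> * \<bar>g y - g x\<bar> + \<bar>f y - f x\<bar> * \<bar>g x\<bar>"
    by (metis abs_mult abs_triangle_ineq)
  also have "\<dots> \<le> F * (B * \<bar>y - x\<bar>) + (A * \<bar>y - x\<bar>) * G"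
    by (intro add_mono mult_mono assms) (use assms(1)[of x] assms(3)[of x y] assms(5,6) in auto)
  finally show ?thesis by (simp add: algebra_simps)
qed

lemma exp_neg_lipschitz:
  fixes c x y :: real
  assumes "0 \<le> c" "0 \<le> x" "0 \<le> y"
  shows "\<bar>exp (- (c * y)) - exp (- (c * x))\<bar> \<le> c * \<bar>y - x\<bar>"
proof -
  have *: "exp (- (c * x)) - exp (- (c * y)) \<le> c * (y - x)" if "0 \<le> x" "x \<le> y" for x y
  proof -
    have "1 - exp (- (c * (y - x))) \<le> c * (y - x)"
      using exp_ge_add_one_self[of "- (c * (y - x))"] by simp
    moreover have "exp (- (c * x)) - exp (- (c * y)) = exp (- (c * x)) * (1 - exp (- (c * (y - x))))"
      by (simp add: algebra_simps flip: exp_add)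
    moreover have "\<dots> \<le> 1 * (1 - exp (- (c * (y - x))))"
      by (intro mult_right_mono) (use assms that in auto)
    ultimately show ?thesis by simp
  qed
  show ?thesis
  proof (cases "x \<le> y")
    case True
    then have "exp (- (c * y)) \<le> exp (- (c * x))" using assms by (simp add: mult_left_mono)
    with *[of x y] True assms show ?thesis by simp
  next
    case False
    then have "exp (- (c * x)) \<le> exp (- (c * y))" using assms by (simp add: mult_left_mono)
    with *[of y x] False assms show ?thesis by simp
  qed
qed

text \<open>The function exp(-ru) \<open>\<psi>\<close> u plus the integral of r exp(-rs)
  \<open>k\<close> s over [0,u] has derivative exp(-ru) (\<open>\<psi>\<close>' - r
  \<open>\<psi>\<close> + r \<open>k\<close>), which is nonpositive off \<open>Z\<close>. Hence it
  never exceeds its initial value \<open>\<psi> 0\<close>, and letting u tend to infinity leaves the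
  mean of \<open>k\<close> at an exponential time. Differentiability is asked only almost everywhere
  because the fluid equation holds only there.\<close>

lemma nn_integral_exponential_le:
  fixes \<psi> k :: "real \<Rightarrow> real"
  assumes r: "0 < r" and \<psi>0: "\<And>u. 0 \<le> u \<Longrightarrow> 0 \<le> \<psi> u" and k0: "\<And>u. 0 \<le> u \<Longrightarrow> 0 \<le> k u"
    and contk: "continuous_on UNIV k" and Z: "negligible Z"
    and bd: "\<And>U. \<exists>B. \<forall>u\<in>{0..U}. \<bar>\<psi> u\<bar> \<le> B"
    and lip: "\<And>U. \<exists>B. \<forall>x\<in>{0..U}. \<forall>y\<in>{0..U}. \<bar>\<psi> y - \<psi> x\<bar> \<le> B * \<bar>y - x\<bar>"
    and der: "\<And>x. 0 < x \<Longrightarrow> x \<notin> Z \<Longrightarrow> \<exists>D. (\<psi> has_real_derivative D) (at x) \<and> D \<le> r * \<psi> x - r * k x"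
  shows "(\<integral>\<^sup>+u. ennreal (k u) \<partial>density lborel (exponential_density r)) \<le> ennreal (\<psi> 0)"
proof -
  define f where "f u = r * exp (- (r * u)) * k u" for u
  have contf: "continuous_on A f" for A unfolding f_def
    by (intro continuous_intros continuous_on_subset[OF contk]) auto
  have f0: "0 \<le> f u" if "0 \<le> u" for u using that k0 r by (simp add: f_def)
  have [measurable]: "f \<in> borel_measurable borel" "k \<in> borel_measurable borel"
    using contf[of UNIV] contk by (auto intro: borel_measurable_continuous_onI)
  have fin: "(\<integral>\<^sup>+u. ennreal (f u) * indicator {0..U} u \<partial>lborel) \<le> ennreal (\<psi> 0)" if U: "0 \<le> U" for U
  proof -
    \<comment> \<open>The lower limit -1 makes 0 an interior point, so that \<open>F\<close> has a
      two-sided derivative on all of {0..U}; only differences of \<open>F\<close> matter.\<close>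
    define F where "F u = integral {-1..u} f" for u
    have F': "(F has_real_derivative f u) (at u)" if "u \<in> {0..U}" for u
      using integral_has_real_derivative[OF contf, of u "-1" "U + 1"] that at_within_Icc_at[of "-1" u "U + 1"]
      unfolding F_def by simp
    have eq: "(\<integral>\<^sup>+u. ennreal (f u) * indicator {0..U} u \<partial>lborel) = ennreal (F U - F 0)"
      by (rule nn_integral_FTC_Icc[OF _ F']) (use f0 U in simp_all)
    define H where "H u = exp (- (r * u)) * \<psi> u + F u" for u
    obtain B1 where B1: "\<And>u. u \<in> {0..U} \<Longrightarrow> \<bar>\<psi> u\<bar> \<le> B1"
      using bd[of U] by blast
    obtain B2 where B2: "\<And>x y. x \<in> {0..U} \<Longrightarrow> y \<in> {0..U} \<Longrightarrow> \<bar>\<psi> y - \<psi> x\<bar> \<le> B2 * \<bar>y - x\<bar>"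
      using lip[of U] by blast
    have "compact (f ` {0..U})" by (intro compact_continuous_image contf) simp
    then have "bounded (f ` {0..U})" by (rule compact_imp_bounded)
    then obtain B3 where B3: "\<And>u. u \<in> {0..U} \<Longrightarrow> \<bar>f u\<bar> \<le> B3"
      unfolding bounded_iff real_norm_def by blast
    have FL: "\<bar>F y - F x\<bar> \<le> B3 * \<bar>y - x\<bar>" if "x \<in> {0..U}" "y \<in> {0..U}" for x y
    proof -
      have "norm (F y - F x) \<le> B3 * norm (y - x)"
      proof (rule field_differentiable_bound[of "{0..U}" F f])
        show "norm (f z) \<le> B3" if "z \<in> {0..U}" for z using B3[OF that] by simp
      qed (fact convex_real_interval has_field_derivative_at_within[OF F'] that)+
      then show ?thesis by simp
    qed
    have HL: "\<bar>H y - H x\<bar> \<le> ((1 * B2 + r * B1) + B3) * \<bar>y - x\<bar>" if "x \<in> {0..U}" "y \<in> {0..U}" for x y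
    proof -
      have "\<bar>exp (- (r * y)) * \<psi> y - exp (- (r * x)) * \<psi> x\<bar> \<le> (1 * B2 + r * B1) * \<bar>y - x\<bar>"
        by (rule lipschitz_mult_bounded[where S="{0..U}"])
           (use that r B1 B2 exp_neg_lipschitz[of r] in auto)
      moreover have "H y - H x = (exp (- (r * y)) * \<psi> y - exp (- (r * x)) * \<psi> x) + (F y - F x)"
        by (simp add: H_def)
      ultimately show ?thesis using FL[OF that] by (simp only: distrib_right)
    qed
    have "H U \<le> H 0"
    proof (rule ae_nonpos_deriv_nonincreasing[OF U _ Z HL])
      have "((1 * B2 + r * B1) + B3) \<le> \<bar>(1 * B2 + r * B1) + B3\<bar>" by simp
      then have "\<bar>(1 * B2 + r * B1) + B3\<bar>-lipschitz_on {0..U} H"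
        by (intro lipschitz_onI)
           (auto simp: dist_real_def intro!: order_trans[OF HL] mult_right_mono)
      then show "continuous_on {0..U} H" by (rule lipschitz_on_continuous_on)
      fix x assume x: "0 < x" "x < U" "x \<notin> Z"
      then obtain D where D: "(\<psi> has_real_derivative D) (at x)" "D \<le> r * \<psi> x - r * k x"
        using der by blast
      have "(F has_real_derivative f x) (at x)"
        using F'[of x] x by simp
      then have "(H has_real_derivative (- r * exp (- (r * x)) * \<psi> x + D * exp (- (r * x)) + f x)) (at x)"
        unfolding H_def by (auto intro!: derivative_eq_intros D)
      moreover have "- r * exp (- (r * x)) * \<psi> x + D * exp (- (r * x)) + f x
         = exp (- (r * x)) * (D - (r * \<psi> x - r * k x))"
        by (simp add: f_def algebra_simps)
      moreover have "\<dots> \<le> 0" using D by (simp add: mult_nonneg_nonpos)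
      ultimately show "\<exists>D\<le>0. (H has_real_derivative D) (at x)" by auto
    qed auto
    \<comment> \<open>The boundary term at U is dropped by its sign, so no decay of
      \<open>\<psi>\<close> at infinity has to be known.\<close>
    moreover have "0 \<le> exp (- (r * U)) * \<psi> U" using \<psi>0[OF U] by simp
    ultimately have "F U - F 0 \<le> \<psi> 0" by (simp add: H_def)
    then show ?thesis unfolding eq by (rule ennreal_leI)
  qed
  have "(\<integral>\<^sup>+u. ennreal (k u) \<partial>density lborel (exponential_density r))
      = (\<integral>\<^sup>+u. ennreal (exponential_density r u) * ennreal (k u) \<partial>lborel)"
    by (subst nn_integral_density) auto
  also have "\<dots> = (\<integral>\<^sup>+u. (SUP n::nat. ennreal (f u) * indicator {0..real n} u) \<partial>lborel)"
  proof (intro nn_integral_cong)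
    fix u :: real
    show "ennreal (exponential_density r u) * ennreal (k u) = (SUP n::nat. ennreal (f u) * indicator {0..real n} u)"
    proof (cases "0 \<le> u")
      case True
      obtain n0 where n0: "u \<le> real n0" using real_arch_simple by blast
      have "(SUP n::nat. ennreal (f u) * indicator {0..real n} u) = ennreal (f u)"
        by (rule antisym[OF SUP_least SUP_upper2[of n0]]) (use True n0 in \<open>auto split: split_indicator\<close>)
      then show ?thesis using True k0[OF True] r
        by (simp add: exponential_density_def f_def mult.commute flip: ennreal_mult')
    qed (auto simp: exponential_density_def)
  qed
  also have "\<dots> = (SUP n::nat. \<integral>\<^sup>+u. ennreal (f u) * indicator {0..real n} u \<partial>lborel)"
    by (rule nn_integral_monotone_convergence_SUP)
       (auto simp: incseq_def le_fun_def split: split_indicator)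
  also have "\<dots> \<le> ennreal (\<psi> 0)" by (intro SUP_least fin) simp
  finally show ?thesis .
qed

section \<open>Geometrically weighted sums of bounded sequences, the linear form behind the squared
  norm\<close>

definition wsum :: "(nat \<Rightarrow> real) \<Rightarrow> real" where
  "wsum x = (\<Sum>i. (1/2) ^ i * x i)"

lemma summable_wsum:
  assumes "Bseq x"
  shows "summable (\<lambda>i. (1/2::real) ^ i * x i)"
proof -
  obtain B where B: "\<And>i. \<bar>x i\<bar> \<le> B" using assms by (auto simp: Bseq_def)
  show ?thesis
  proof (rule summable_comparison_test'[of "\<lambda>i. (1/2::real) ^ i * B" 0])
    show "summable (\<lambda>i. (1/2::real) ^ i * B)" by (intro summable_mult2 summable_geometric) simp
    show "norm ((1/2::real) ^ i * x i) \<le> (1/2) ^ i * B" for i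
      using B[of i] by (simp add: abs_mult)
  qed
qed

lemma wsum_const: "wsum (\<lambda>i. c) = 2 * c"
  unfolding wsum_def by (subst suminf_mult2[symmetric]) (auto simp: suminf_geometric)

lemma wsum_mono:
  assumes "Bseq x" "Bseq y" "\<And>i. x i \<le> y i"
  shows "wsum x \<le> wsum y"
  unfolding wsum_def
  by (rule suminf_le) (use assms in \<open>auto intro: mult_left_mono summable_wsum\<close>)

lemma wsum_add:
  assumes "Bseq x" "Bseq y"
  shows "wsum (\<lambda>i. x i + y i) = wsum x + wsum y"
  unfolding wsum_def
  by (subst suminf_add) (use summable_wsum assms in \<open>auto simp: algebra_simps\<close>)

lemma wsum_cmult:
  assumes "Bseq x"
  shows "wsum (\<lambda>i. c * x i) = c * wsum x"
  unfolding wsum_def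
  by (subst suminf_mult[symmetric]) (use summable_wsum assms in \<open>auto simp: algebra_simps\<close>)

lemma wsum_diff:
  assumes "Bseq x" "Bseq y"
  shows "wsum (\<lambda>i. x i - y i) = wsum x - wsum y"
  unfolding wsum_def
  by (subst suminf_diff) (use summable_wsum assms in \<open>auto simp: algebra_simps\<close>)

lemma wsum_nonneg:
  assumes "Bseq x" "\<And>i. 0 \<le> x i"
  shows "0 \<le> wsum x"
  using wsum_mono[of "\<lambda>_. 0" x] assms by (simp add: wsum_const)

lemma abs_wsum_le:
  assumes "\<And>i. \<bar>x i\<bar> \<le> B"
  shows "\<bar>wsum x\<bar> \<le> 2 * B"
proof -
  have "Bseq x" using assms by (intro BseqI'[of _ B]) auto
  then have "wsum x \<le> 2 * B" "2 * - B \<le> wsum x"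
    using wsum_mono[of x "\<lambda>_. B"] wsum_mono[of "\<lambda>_. - B" x] assms
    unfolding wsum_const by (auto simp: abs_le_iff minus_le_iff)
  then show ?thesis by simp
qed

lemma wsum_split:
  assumes "Bseq x"
  shows "wsum x = x 0 + wsum (\<lambda>i. x (Suc i)) / 2"
proof -
  have "wsum x = (\<Sum>i. (1/2) ^ Suc i * x (Suc i)) + x 0"
    unfolding wsum_def by (subst suminf_split_head) (use summable_wsum assms in auto)
  also have "(\<Sum>i. (1/2) ^ Suc i * x (Suc i)) = (\<Sum>i. (1/2) * ((1/2) ^ i * x (Suc i)))"
    by (simp add: mult.assoc)
  also have "\<dots> = (1/2) * wsum (\<lambda>i. x (Suc i))"
    unfolding wsum_def by (rule suminf_mult) (use summable_wsum assms in \<open>auto simp: Bseq_Suc_iff\<close>)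
  finally show ?thesis by simp
qed

lemma wsum_lipschitz:
  fixes f :: "real \<Rightarrow> nat \<Rightarrow> real"
  assumes "Bseq (f x)" "Bseq (f y)" "\<And>i. \<bar>f y i - f x i\<bar> \<le> A * \<bar>y - x\<bar>"
  shows "\<bar>wsum (f y) - wsum (f x)\<bar> \<le> 2 * A * \<bar>y - x\<bar>"
  using abs_wsum_le[of "\<lambda>i. f y i - f x i" "A * \<bar>y - x\<bar>"] assms by (simp add: wsum_diff mult.assoc)

text \<open>Tannery's theorem, the dominated convergence theorem for series, applied to the
  difference quotients: the Lipschitz constant common to all coordinates bounds every quotient by
  \<open>A\<close>, and the weights are summable.\<close>

lemma wsum_has_derivative:
  fixes f :: "real \<Rightarrow> nat \<Rightarrow> real"
  assumes d: "d > 0"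
    and bd: "\<And>y. Bseq (f y)"
    and lip: "\<And>y i. \<bar>y - x\<bar> < d \<Longrightarrow> \<bar>f y i - f x i\<bar> \<le> A * \<bar>y - x\<bar>"
    and der: "\<And>i. ((\<lambda>y. f y i) has_real_derivative f' i) (at x)"
  shows "((\<lambda>y. wsum (f y)) has_real_derivative wsum f') (at x)"
  unfolding has_field_derivative_iff
proof -
  have ev: "eventually (\<lambda>y. y \<noteq> x \<and> \<bar>y - x\<bar> < d) (at x)"
    using d by (auto simp: eventually_at dist_real_def)
  have "((\<lambda>y. \<Sum>i. (1/2) ^ i * ((f y i - f x i) / (y - x))) \<longlongrightarrow> (\<Sum>i. (1/2) ^ i * f' i)) (at x)"
  proof (rule conjunct2[OF conjunct2[OF tannerys_theorem]])
    show "((\<lambda>y. (1/2) ^ i * ((f y i - f x i) / (y - x))) \<longlongrightarrow> (1/2) ^ i * f' i) (at x)" for i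
      using der[of i] unfolding has_field_derivative_iff by (intro tendsto_intros)
    show "summable (\<lambda>i. (1/2::real) ^ i * A)" by (intro summable_mult2 summable_geometric) simp
    have "norm ((1/2) ^ i * ((f y i - f x i) / (y - x))) \<le> (1/2) ^ i * A"
      if "y \<noteq> x \<and> \<bar>y - x\<bar> < d" for y i
      using lip[of y i] that by (simp add: abs_mult divide_le_eq)
    then show "\<forall>\<^sub>F (i, y) in sequentially \<times>\<^sub>F at x. norm ((1/2) ^ i * ((f y i - f x i) / (y - x))) \<le> (1/2) ^ i * A"
      unfolding eventually_prod_filter
      by (intro exI[of _ "\<lambda>_. True"] exI[of _ "\<lambda>y. y \<noteq> x \<and> \<bar>y - x\<bar> < d"]) (use ev in auto)
  qed simp
  then show "((\<lambda>y. (wsum (f y) - wsum (f x)) / (y - x)) \<longlongrightarrow> wsum f') (at x)"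
    unfolding wsum_def[of f']
  proof (rule Lim_transform_eventually)
    show "\<forall>\<^sub>F y in at x. (\<Sum>i. (1/2) ^ i * ((f y i - f x i) / (y - x))) = (wsum (f y) - wsum (f x)) / (y - x)"
      using ev
    proof eventually_elim
      case (elim y)
      have "wsum (f y) - wsum (f x) = wsum (\<lambda>i. f y i - f x i)"
        by (rule wsum_diff[symmetric]) (rule bd)+
      also have "\<dots> = wsum (\<lambda>i. (y - x) * ((f y i - f x i) / (y - x)))"
        using elim by simp
      also have "\<dots> = (y - x) * wsum (\<lambda>i. (f y i - f x i) / (y - x))"
        by (intro wsum_cmult BseqI'[of _ A]) (use lip[of y] elim in \<open>auto simp: divide_le_eq\<close>)
      finally show ?case using elim by (simp add: wsum_def)
    qed
  qed
qed

section \<open>Increments and drift of the N-station system\<close>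

lemma Bseq_plus:
  fixes f g :: "nat \<Rightarrow> real"
  assumes "Bseq f" "Bseq g"
  shows "Bseq (\<lambda>i. f i + g i)"
proof -
  obtain F G where "\<And>i. norm (f i) \<le> F" "\<And>i. norm (g i) \<le> G" using assms unfolding Bseq_def by blast
  then show ?thesis by (intro BseqI'[of _ "F + G"]) (meson norm_triangle_mono)
qed

lemma Bseq_diff:
  fixes f g :: "nat \<Rightarrow> real"
  assumes "Bseq f" "Bseq g"
  shows "Bseq (\<lambda>i. f i - g i)"
  using Bseq_plus[OF assms(1), of "\<lambda>i. - g i"] assms(2) by (simp add: Bseq_minus_iff)

lemma Bseq_sum:
  fixes f :: "'a \<Rightarrow> nat \<Rightarrow> real"
  assumes "\<And>a. a \<in> A \<Longrightarrow> Bseq (f a)"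
  shows "Bseq (\<lambda>i. \<Sum>a\<in>A. f a i)"
  using assms by (induction A rule: infinite_finite_induct) (auto intro: Bseq_plus)

lemma Bseq_power2:
  fixes f :: "nat \<Rightarrow> real"
  shows "Bseq f \<Longrightarrow> Bseq (\<lambda>i. (f i)\<^sup>2)"
  unfolding power2_eq_square by (rule Bseq_mult)

lemma Bseq_cmult: "Bseq f \<Longrightarrow> Bseq (\<lambda>i. c * f i :: real)"
  by (rule Bseq_mult) auto

lemmas Bseq_intros = Bseq_plus Bseq_diff Bseq_mult Bseq_sum Bseq_power2 Bseq_cmult Bfun_const

lemma wsum_sum:
  assumes "\<And>a. a \<in> A \<Longrightarrow> Bseq (f a)"
  shows "wsum (\<lambda>i. \<Sum>a\<in>A. f a i) = (\<Sum>a\<in>A. wsum (f a))"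
  using assms
proof (induction A rule: infinite_finite_induct)
  case (insert a A)
  then show ?case by (simp add: wsum_add Bseq_intros)
qed (simp_all add: wsum_const)

section \<open>Tail sums of the queue lengths and their increments\<close>

lemma Sfrac_eq_sum: "Sfrac N q i = (\<Sum>n<N. of_bool (i \<le> q ! n)) / real N"
proof -
  have "{n. n < N \<and> i \<le> q ! n} = {n \<in> {..<N}. i \<le> q ! n}" by auto
  then show ?thesis by (simp add: Sfrac_def sum.If_cases of_bool_def Int_def)
qed

text \<open>A queue is counted once at each level from i up to its length, that is
  \<open>q ! n + 1 - i\<close> times with truncated subtraction. Each queue contributes a finite
  sum, so the series in \<open>Vvec\<close> always converges.\<close>

lemma Sfrac_sums_Vvec: "(\<lambda>j. Sfrac N q (i + j)) sums ((\<Sum>n<N. real (q ! n + 1 - i)) / real N)"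
proof -
  have "(\<lambda>j. of_bool (i + j \<le> q ! n)) sums real (q ! n + 1 - i)" for n
  proof -
    have "(\<lambda>j. of_bool (i + j \<le> q ! n) :: real) sums (\<Sum>j<q ! n + 1 - i. of_bool (i + j \<le> q ! n))"
      by (rule sums_finite) auto
    also have "(\<Sum>j<q ! n + 1 - i. of_bool (i + j \<le> q ! n) :: real) = (\<Sum>j<q ! n + 1 - i. 1)"
      by (rule sum.cong) auto
    finally show ?thesis by simp
  qed
  then show ?thesis unfolding Sfrac_eq_sum by (intro sums_divide sums_sum)
qed

lemma Vvec_eq: "Vvec N q i = (\<Sum>n<N. real (q ! n + 1 - i)) / real N"
  unfolding Vvec_def using Sfrac_sums_Vvec by (rule sums_unique[symmetric])

lemma Vvec_nonneg: "0 \<le> Vvec N q i"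
  by (simp add: Vvec_eq sum_nonneg)

lemma Vvec_le_Vvec_0: "Vvec N q i \<le> Vvec N q 0"
  unfolding Vvec_eq by (intro divide_right_mono sum_mono) auto

lemma Vvec_diff: "Vvec N q i - Vvec N q (Suc i) = Sfrac N q i"
  unfolding Vvec_eq Sfrac_eq_sum diff_divide_distrib[symmetric] sum_subtractf[symmetric]
  by (intro arg_cong2[where f="(/)"] sum.cong) (auto simp: of_bool_def)

lemma Vvec_0:
  assumes "1 \<le> N"
  shows "Vvec N q 0 = 1 + Vvec N q 1"
  using Vvec_diff[of N q 0] assms by (simp add: Sfrac_eq_sum)

text \<open>This translates between the longest queue, which governs a central token, and the sign
  of a coordinate, which governs the fluid model.\<close>

lemma Vvec_pos_iff:
  assumes "1 \<le> N" "1 \<le> i"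
  shows "0 < Vvec N q i \<longleftrightarrow> i \<le> Max ((\<lambda>k. q ! k) ` {..<N})"
proof -
  have "0 < Vvec N q i \<longleftrightarrow> 0 < (\<Sum>n<N. real (q ! n + 1 - i))"
    using assms by (simp add: Vvec_eq zero_less_divide_iff)
  also have "\<dots> \<longleftrightarrow> (\<exists>n<N. i \<le> q ! n)"
  proof -
    have "(\<Sum>n<N. real (q ! n + 1 - i)) = 0 \<longleftrightarrow> (\<forall>n<N. \<not> i \<le> q ! n)"
      by (subst sum_nonneg_eq_0_iff) (auto simp: not_le Suc_le_eq)
    moreover have "0 \<le> (\<Sum>n<N. real (q ! n + 1 - i))" by (rule sum_nonneg) simp
    ultimately show ?thesis by (metis less_le not_less_iff_gr_or_eq)
  qed
  also have "\<dots> \<longleftrightarrow> i \<le> Max ((\<lambda>k. q ! k) ` {..<N})"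
    using assms by (subst Max_ge_iff) (auto simp: lessThan_empty_iff)
  finally show ?thesis .
qed

lemma Vvec_update:
  assumes "n < N" "length q = N"
  shows "Vvec N (q[n := x]) i = Vvec N q i + (real (x + 1 - i) - real (q ! n + 1 - i)) / real N"
proof -
  have "(\<Sum>m<N. real (q[n := x] ! m + 1 - i)) = real (x + 1 - i) + (\<Sum>m\<in>{..<N} - {n}. real (q ! m + 1 - i))"
    using assms by (subst sum.remove[of _ n]) (auto intro!: sum.cong)
  moreover have "(\<Sum>m<N. real (q ! m + 1 - i)) = real (q ! n + 1 - i) + (\<Sum>m\<in>{..<N} - {n}. real (q ! m + 1 - i))"
    using assms by (subst sum.remove[of _ n]) auto
  ultimately show ?thesis by (simp add: Vvec_eq add_divide_distrib diff_divide_distrib)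
qed

text \<open>Holds for every selector j, so the tie-breaking rule never influences the tail
  sums.\<close>

lemma longest_nth:
  assumes "1 \<le> N"
  shows "longest N q ! (j mod length (longest N q)) < N"
    and "q ! (longest N q ! (j mod length (longest N q))) = Max ((\<lambda>k. q ! k) ` {..<N})"
proof -
  let ?S = "{n. n < N \<and> q ! n = Max ((\<lambda>m. q ! m) ` {..<N})}"
  have fin: "finite ?S" by simp
  have "Max ((\<lambda>m. q ! m) ` {..<N}) \<in> (\<lambda>m. q ! m) ` {..<N}"
    using assms by (intro Max_in) (auto simp: lessThan_empty_iff)
  then have "?S \<noteq> {}" by auto
  then have "length (longest N q) > 0" using fin by (simp add: longest_def card_gt_0_iff)
  then have "longest N q ! (j mod length (longest N q)) \<in> set (longest N q)" by simp
  then have "longest N q ! (j mod length (longest N q)) \<in> ?S" using fin by (simp add: longest_def)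
  then show "longest N q ! (j mod length (longest N q)) < N"
    "q ! (longest N q ! (j mod length (longest N q))) = Max ((\<lambda>k. q ! k) ` {..<N})" by auto
qed

lemma length_step [simp]: "length (step N e q) = length q"
  by (cases e) (auto simp: Let_def)

text \<open>Coordinate 0 is always one more than coordinate 1, so its increments are those of
 coordinate 1; hence the index \<open>max 1 i\<close>.\<close>

lemma Vvec_step_Arr:
  assumes "n < N" "length q = N"
  shows "Vvec N (step N (Arr n) q) i = Vvec N q i + of_bool (max 1 i - 1 \<le> q ! n) / real N"
  using assms by (auto simp: Vvec_update of_bool_def max_def)

lemma Vvec_step_Loc:
  assumes "n < N" "length q = N"
  shows "Vvec N (step N (Loc n) q) i = Vvec N q i - of_bool (max 1 i \<le> q ! n) / real N"
proof -
  have "real (q ! n - 1 + 1 - i) - real (q ! n + 1 - i) = - of_bool (max 1 i \<le> q ! n)"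
    by (cases "q ! n") (auto simp: of_bool_def max_def)
  then show ?thesis using assms by (simp add: Vvec_update)
qed

text \<open>Serving a queue of maximal length m lowers exactly the coordinates up to m, and from 1
  on these are the positive ones. In an empty system every coordinate from 1 on vanishes and nothing
  moves.\<close>

lemma Vvec_step_Cen:
  assumes N: "1 \<le> N" and len: "length q = N"
  shows "Vvec N (step N (Cen j) q) i = Vvec N q i - of_bool (0 < Vvec N q (max 1 i)) / real N"
proof -
  let ?k = "longest N q ! (j mod length (longest N q))"
  let ?m = "Max ((\<lambda>k. q ! k) ` {..<N})"
  have iff: "0 < Vvec N q (max 1 i) \<longleftrightarrow> max 1 i \<le> ?m" using Vvec_pos_iff[OF N, of "max 1 i"] by simp
  show ?thesis
  proof (cases "?m = 0")
    case False
    \<comment> \<open>A central token that finds work acts as a local token at the selected longest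
      queue.\<close>
    then have "step N (Cen j) q = step N (Loc ?k) q"
      using longest_nth(2)[OF N, of q j] by (simp add: Let_def)
    then show ?thesis
      unfolding iff Vvec_step_Loc[OF longest_nth(1)[OF N] len, symmetric] longest_nth(2)[OF N, of q j, symmetric]
      by (simp only:)
  qed (use iff in \<open>simp add: Let_def\<close>)
qed

section \<open>Averages over one random event\<close>

definition mean_ev :: "real \<Rightarrow> real \<Rightarrow> nat \<Rightarrow> (event \<Rightarrow> real) \<Rightarrow> real" where
  "mean_ev lam p N f = lam / (lam + 1) * ((\<Sum>n<N. f (Arr n)) / real N)
     + 1 / (lam + 1) * ((1 - p) * ((\<Sum>n<N. f (Loc n)) / real N)
                        + p * ((\<Sum>j<fact N. f (Cen j)) / fact N))"

text \<open>Bridge from the integral to explicit finite sums: for real-valued functions these are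
  linear without any integrability condition, and they commute with \<open>wsum\<close>.\<close>

lemma nn_integral_ev_pmf:
  assumes "0 \<le> lam" "0 \<le> p" "p \<le> 1" "1 \<le> N" and f: "\<And>e. 0 \<le> f e"
  shows "(\<integral>\<^sup>+e. ennreal (f e) \<partial>measure_pmf (ev_pmf lam p N)) = ennreal (mean_ev lam p N f)"
proof -
  have unif: "(\<integral>\<^sup>+j. ennreal (g j) \<partial>measure_pmf (pmf_of_set {..<K})) = ennreal ((\<Sum>j<K. g j) / real K)"
    if "K > 0" "\<And>j. 0 \<le> g j" for K :: nat and g :: "nat \<Rightarrow> real"
    using that by (subst nn_integral_pmf_of_set)
      (auto simp: lessThan_empty_iff divide_ennreal sum_nonneg ennreal_of_nat_eq_real_of_nat)
  define A where "A = (\<Sum>n<N. f (Arr n)) / real N"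
  define L where "L = (\<Sum>n<N. f (Loc n)) / real N"
  define C where "C = (\<Sum>j<fact N. f (Cen j)) / real (fact N)"
  have nn: "0 \<le> A" "0 \<le> L" "0 \<le> C" using f by (auto simp: A_def L_def C_def sum_nonneg)
  have c: "1 - lam / (lam + 1) = 1 / (lam + 1)" using assms by (simp add: field_simps)
  have "lam / (lam + 1) \<le> 1" using assms by simp
  then have "(\<integral>\<^sup>+e. ennreal (f e) \<partial>measure_pmf (ev_pmf lam p N)) =
    ennreal A * ennreal (lam / (lam + 1))
      + (ennreal L * ennreal (1 - p) + ennreal C * ennreal p) * ennreal (1 / (lam + 1))"
    unfolding ev_pmf_def using assms unif[of N "\<lambda>n. f (Arr n)"] unif[of N "\<lambda>n. f (Loc n)"] unif[of "fact N" "\<lambda>n. f (Cen n)"] f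
    by (simp add: c A_def L_def C_def)
  also have "\<dots> = ennreal (mean_ev lam p N f)"
    using assms nn by (simp add: mean_ev_def A_def[symmetric] L_def[symmetric] C_def[symmetric]
      flip: ennreal_mult ennreal_plus) (simp add: mult.commute C_def)
  finally show ?thesis .
qed

lemma mean_ev_mono:
  assumes "0 \<le> lam" "0 \<le> p" "p \<le> 1"
    and "\<And>n. n < N \<Longrightarrow> f (Arr n) \<le> g (Arr n)" "\<And>n. n < N \<Longrightarrow> f (Loc n) \<le> g (Loc n)" "\<And>j. f (Cen j) \<le> g (Cen j)"
  shows "mean_ev lam p N f \<le> mean_ev lam p N g"
  unfolding mean_ev_def using assms
  by (intro add_mono mult_left_mono divide_right_mono sum_mono) auto

lemma mean_ev_affine:
  assumes "0 \<le> lam" "1 \<le> N"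
  shows "mean_ev lam p N (\<lambda>e. a + b * f e) = a + b * mean_ev lam p N f"
proof -
  have *: "(\<Sum>n<K. a + b * g n) / real K = a + b * ((\<Sum>n<K. g n) / real K)" if "K > 0" for K :: nat and g
    using that by (simp add: sum.distrib sum_distrib_left[symmetric] field_simps)
  have **: "lam / (lam + 1) * (a + b * x) + 1 / (lam + 1) * ((1 - p) * (a + b * y) + p * (a + b * z))
     = a + b * (lam / (lam + 1) * x + 1 / (lam + 1) * ((1 - p) * y + p * z))" for x y z
    using assms by (simp add: divide_simps) (simp add: algebra_simps)
  have "N > 0" "fact N > (0::nat)" using assms by auto
  from *[OF this(1)] *[OF this(2)] show ?thesis
    unfolding mean_ev_def of_nat_fact by (simp only: **)
qed

lemma mean_ev_wsum:
  assumes "\<And>n. n < N \<Longrightarrow> Bseq (f (Arr n))" "\<And>n. n < N \<Longrightarrow> Bseq (f (Loc n))" "\<And>j. Bseq (f (Cen j))"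
  shows "mean_ev lam p N (\<lambda>e. wsum (f e)) = wsum (\<lambda>i. mean_ev lam p N (\<lambda>e. f e i))"
proof -
  have "wsum (\<lambda>i. a * x i + b * (c * y i + d * z i)) = a * wsum x + b * (c * wsum y + d * wsum z)"
    if "Bseq x" "Bseq y" "Bseq z" for a b c d and x y z :: "nat \<Rightarrow> real"
    by (subst wsum_add wsum_cmult; (intro Bseq_intros that)?)+ rule
  note * = this
  have bs: "Bseq (\<lambda>i. \<Sum>n<N. f (Arr n) i)" "Bseq (\<lambda>i. \<Sum>n<N. f (Loc n) i)"
      "Bseq (\<lambda>i. \<Sum>j<fact N. f (Cen j) i)"
    using assms by (auto intro!: Bseq_sum)
  have "wsum (\<lambda>i. \<Sum>n<N. f (Arr n) i) = (\<Sum>n<N. wsum (f (Arr n)))"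
    "wsum (\<lambda>i. \<Sum>n<N. f (Loc n) i) = (\<Sum>n<N. wsum (f (Loc n)))"
    "wsum (\<lambda>i. \<Sum>j<fact N. f (Cen j) i) = (\<Sum>j<fact N. wsum (f (Cen j)))"
    by (rule wsum_sum; use assms in simp)+
  with *[OF bs, of "lam / (lam + 1) / N" "1 / (lam + 1)" "(1 - p) / N" "p / fact N"]
  show ?thesis unfolding mean_ev_def by simp
qed

text \<open>The generator of the chain applied to coordinate j: events come at rate N(lam + 1) and
  each moves a coordinate by at most 1/N. It differs from the fluid velocity only in the central
  term, where p times the indicator of a positive coordinate replaces \<open>gfl\<close>. The index
  is meant to be at least 1.\<close>

definition drift :: "real \<Rightarrow> real \<Rightarrow> nat \<Rightarrow> nat list \<Rightarrow> nat \<Rightarrow> real" where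
  "drift lam p N q j = lam * (Vvec N q (j - 1) - Vvec N q j) - (1 - p) * (Vvec N q j - Vvec N q (j + 1))
     - p * of_bool (0 < Vvec N q j)"

text \<open>Scaled by N so that all increments lie in {-1, 0, 1}.\<close>

definition jump :: "nat \<Rightarrow> nat list \<Rightarrow> event \<Rightarrow> nat \<Rightarrow> real" where
  "jump N q e i = real N * (Vvec N (step N e q) i - Vvec N q i)"

lemma jump_simps:
  assumes "1 \<le> N" "length q = N"
  shows "n < N \<Longrightarrow> jump N q (Arr n) i = of_bool (max 1 i - 1 \<le> q ! n)"
    and "n < N \<Longrightarrow> jump N q (Loc n) i = - of_bool (max 1 i \<le> q ! n)"
    and "jump N q (Cen j) i = - of_bool (0 < Vvec N q (max 1 i))"
  using assms unfolding jump_def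
  by (auto simp del: step.simps simp: Vvec_step_Arr Vvec_step_Loc Vvec_step_Cen)

lemma mean_ev_jump:
  assumes "0 \<le> lam" "1 \<le> N" "length q = N"
  shows "mean_ev lam p N (\<lambda>e. jump N q e i) = drift lam p N q (max 1 i) / (lam + 1)"
proof -
  have "(\<Sum>n<N. jump N q (Arr n) i) / real N = Vvec N q (max 1 i - 1) - Vvec N q (max 1 i)"
    using Vvec_diff[of N q "max 1 i - 1"] assms by (simp add: jump_simps Sfrac_eq_sum)
  moreover have "(\<Sum>n<N. jump N q (Loc n) i) / real N = - (Vvec N q (max 1 i) - Vvec N q (max 1 i + 1))"
    using Vvec_diff[of N q "max 1 i"] assms by (simp add: jump_simps Sfrac_eq_sum sum_negf)
  moreover have "(\<Sum>j<fact N. jump N q (Cen j) i) / fact N = - of_bool (0 < Vvec N q (max 1 i))"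
    using assms by (simp add: jump_simps)
  ultimately show ?thesis
    using assms unfolding mean_ev_def drift_def by (simp only:) (simp add: divide_simps, simp add: algebra_simps)
qed

lemma abs_jump_le:
  assumes "1 \<le> N" "length q = N"
  shows "n < N \<Longrightarrow> \<bar>jump N q (Arr n) i\<bar> \<le> 1" "n < N \<Longrightarrow> \<bar>jump N q (Loc n) i\<bar> \<le> 1" "\<bar>jump N q (Cen j) i\<bar> \<le> 1"
  using assms by (auto simp: jump_simps)

lemma Bseq_Vvec: "Bseq (Vvec N q)"
  by (rule BseqI'[of _ "Vvec N q 0"]) (simp add: Vvec_nonneg Vvec_le_Vvec_0)

text \<open>The arrival and local terms are linear, and each product of \<open>d j\<close> with a
  neighbouring difference is absorbed by completing a square. The central terms contribute with the
  favourable sign and are discarded.\<close>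

lemma one_sided_lipschitz:
  fixes x y :: "nat \<Rightarrow> real"
  assumes "0 \<le> lam" "lam \<le> 1" "0 \<le> p" "p \<le> 1" and x: "\<And>i. 0 \<le> x i" and y: "\<And>i. 0 \<le> y i" and d: "\<And>i. d i = x i - y i"
  shows "d j * ((lam * (x (j - 1) - x j) - (1 - p) * (x j - x (j + 1)) - p * of_bool (0 < x j))
     - (lam * (y (j - 1) - y j) - (1 - p) * (y j - y (j + 1)) - gfl lam p y j))
     \<le> (d (j - 1))\<^sup>2 + (d (j + 1))\<^sup>2"
proof -
  have prod: "a * b - a * a \<le> b\<^sup>2" for a b :: real
  proof -
    have "b\<^sup>2 - (a * b - a * a) = (a - b / 2)\<^sup>2 + 3 / 4 * b\<^sup>2" by (simp add: power2_eq_square field_simps)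
    also have "\<dots> \<ge> 0" by simp
    finally show ?thesis by simp
  qed
  have g: "0 \<le> gfl lam p y j" "gfl lam p y j \<le> p"
    using assms y[of "j - 1"] by (auto simp: gfl_def)
  \<comment> \<open>If both coordinates are positive the central terms agree. If only
    \<open>x j\<close> is, then \<open>d j\<close> is positive and the fluid rate is at most p. If
    \<open>x j\<close> is 0, then \<open>d j\<close> is nonpositive and so is the difference of the
    rates.\<close>
  have mono: "0 \<le> d j * (p * of_bool (0 < x j) - gfl lam p y j)"
  proof (cases "0 < x j")
    case True
    show ?thesis
    proof (cases "0 < y j")
      case False
      then have "y j = 0" using y[of j] by simp
      then show ?thesis using True g d[of j] by simp
    qed (use True in \<open>simp add: gfl_def\<close>)
  next
    case False
    then have "x j = 0" using x[of j] by simp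
    then show ?thesis using g d[of j] y[of j] by (simp add: mult_nonpos_nonneg)
  qed
  have "d j * ((lam * (x (j - 1) - x j) - (1 - p) * (x j - x (j + 1)) - p * of_bool (0 < x j))
     - (lam * (y (j - 1) - y j) - (1 - p) * (y j - y (j + 1)) - gfl lam p y j))
     = lam * (d j * d (j - 1) - d j * d j) + (1 - p) * (d j * d (j + 1) - d j * d j)
       - d j * (p * of_bool (0 < x j) - gfl lam p y j)"
    unfolding d by (simp add: algebra_simps)
  also have "\<dots> \<le> lam * (d (j - 1))\<^sup>2 + (1 - p) * (d (j + 1))\<^sup>2"
    using mult_left_mono[OF prod[of "d j" "d (j - 1)"], of lam]
      mult_left_mono[OF prod[of "d j" "d (j + 1)"], of "1 - p"] mono assms by linarith
  also have "\<dots> \<le> 1 * (d (j - 1))\<^sup>2 + 1 * (d (j + 1))\<^sup>2"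
    using assms by (intro add_mono mult_right_mono) auto
  finally show ?thesis by simp
qed

text \<open>Far out, shifting the index multiplies a weight by 2 or 1/2. The worst index is 2: it
  occurs on the left for i = 0, 1 and 3, with weights 1 + 1/2 + 1/8 = 13/8, against 1/4 on the
  right. With the factor 2 this gives the ratio 13, which 15 covers.\<close>

lemma wsum_neighbours_le:
  assumes "Bseq d"
  shows "2 * wsum (\<lambda>i. (d (max 1 i - 1))\<^sup>2 + (d (max 1 i + 1))\<^sup>2) \<le> 15 * wsum (\<lambda>i. (d i)\<^sup>2)"
proof -
  define y where "y i = (d i)\<^sup>2" for i
  have y: "Bseq y" "Bseq (\<lambda>i. y (i + k))" "\<And>i. 0 \<le> y i" for k
    using assms by (auto simp: y_def[abs_def] intro!: Bseq_intros Bseq_ignore_initial_segment)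
  \<comment> \<open>Three heads are split off because the truncation \<open>max 1 i\<close> distorts
    the weights only at the indices 0, 1 and 2.\<close>
  have s: "wsum y = y 0 + wsum (\<lambda>i. y (i + 1)) / 2" "wsum (\<lambda>i. y (i + 1)) = y 1 + wsum (\<lambda>i. y (i + 2)) / 2"
    "wsum (\<lambda>i. y (i + 2)) = y 2 + wsum (\<lambda>i. y (i + 3)) / 2"
    using wsum_split[OF y(1)] wsum_split[OF y(2)[of 1]] wsum_split[OF y(2)[of 2]] by (simp_all add: numeral_eq_Suc)
  have nn: "0 \<le> wsum (\<lambda>i. y (i + 3))" "0 \<le> wsum (\<lambda>i. y (i + 2))" using wsum_nonneg[OF y(2)[of 3]] wsum_nonneg[OF y(2)[of 2]] y(3) by simp_all
  have b: "Bseq (\<lambda>i. y (max 1 i - 1))" "Bseq (\<lambda>i. y (max 1 i + 1))"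
    using Bseq_subseq[OF y(1)] by auto
  have "wsum (\<lambda>i. y (max 1 i - 1)) = y 0 + wsum y / 2"
    using wsum_split[OF b(1)] by simp
  moreover have "wsum (\<lambda>i. y (max 1 i + 1)) = y 2 + wsum (\<lambda>i. y (i + 2)) / 2"
    using wsum_split[OF b(2)] by (simp add: numeral_2_eq_2)
  ultimately have "wsum (\<lambda>i. y (max 1 i - 1) + y (max 1 i + 1)) = y 0 + wsum y / 2 + (y 2 + wsum (\<lambda>i. y (i + 2)) / 2)"
    using b by (simp add: wsum_add)
  also have "2 * \<dots> \<le> 15 * wsum y"
  proof -
    have "A = y0 + z1 / 2 \<Longrightarrow> z1 = y1 + z2 / 2 \<Longrightarrow> z2 = y2 + z3 / 2 \<Longrightarrow> 0 \<le> z3 \<Longrightarrow> 0 \<le> z2 \<Longrightarrow>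
      0 \<le> y0 \<Longrightarrow> 0 \<le> y1 \<Longrightarrow> 0 \<le> y2 \<Longrightarrow> 2 * (y0 + A / 2 + (y2 + z2 / 2)) \<le> 15 * A"
      for A y0 y1 y2 z1 z2 z3 :: real by (simp add: field_simps)
    from this[OF s nn y(3) y(3) y(3)] show ?thesis .
  qed
  finally show ?thesis by (simp add: y_def)
qed

section \<open>One step of the Lyapunov function\<close>

text \<open>A fluid path on the whole real line: the path of the theorem is continued to negative
  times as a constant, so that \<open>gap\<close> is continuous everywhere. The null set
  \<open>Z\<close> is common to all coordinates, which lets the weighted sum be differentiated off a
  single exceptional set.\<close>

locale fluid =
  fixes lam p L :: real and v :: "real \<Rightarrow> nat \<Rightarrow> real" and Z :: "real set"
  assumes lam: "0 \<le> lam" "lam < 1" and p: "0 \<le> p" "p \<le> 1"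
    and v_nonneg: "0 \<le> v t i" and v_le: "v t i \<le> v t 0" and v_0: "v t 0 = 1 + v t 1"
    and v_lip: "\<bar>v t i - v s i\<bar> \<le> L * \<bar>t - s\<bar>"
    and Z: "negligible Z"
    and v_deriv: "0 < t \<Longrightarrow> t \<notin> Z \<Longrightarrow> 1 \<le> i \<Longrightarrow> ((\<lambda>s. v s i) has_real_derivative
        (lam * (v t (i - 1) - v t i) - (1 - p) * (v t i - v t (i + 1)) - gfl lam p (v t) i)) (at t)"
begin

lemma L_nonneg: "0 \<le> L"
  using v_lip[of 1 0 0] by simp

section \<open>The squared distance to the fluid path and its variation in time\<close>

definition gap :: "nat \<Rightarrow> nat list \<Rightarrow> real \<Rightarrow> real" where
  "gap N q t = wsum (\<lambda>i. (Vvec N q i - v t i)\<^sup>2)"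

lemma Bseq_v: "Bseq (v t)"
  by (rule BseqI'[of _ "v t 0"]) (simp add: v_nonneg v_le)

lemmas Bseqs = Bseq_intros Bseq_v Bseq_Vvec

lemma gap_nonneg: "0 \<le> gap N q t"
  unfolding gap_def by (intro wsum_nonneg Bseqs) auto

text \<open>Bounds all coordinate differences at once for times in [-U, U]: in both sequences
  coordinate 0 is the largest, and the path moves at speed at most \<open>L\<close>.\<close>

definition bnd :: "nat \<Rightarrow> nat list \<Rightarrow> real \<Rightarrow> real" where
  "bnd N q U = Vvec N q 0 + v 0 0 + L * U"

lemma diff_le_bnd:
  assumes "\<bar>t\<bar> \<le> U"
  shows "\<bar>Vvec N q i - v t i\<bar> \<le> bnd N q U"
proof -
  have "v t i \<le> v t 0" by (rule v_le)
  moreover have "v t 0 - v 0 0 \<le> L * \<bar>t\<bar>" using v_lip[of t 0 0] by simp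
  moreover have "L * \<bar>t\<bar> \<le> L * U" using L_nonneg assms by (intro mult_left_mono)
  ultimately show ?thesis
    using v_nonneg[of t i] v_nonneg[of 0 0] Vvec_nonneg[of N q i] Vvec_le_Vvec_0[of N q i] unfolding bnd_def by linarith
qed

lemma sq_lipschitz:
  assumes "\<bar>x\<bar> \<le> U" "\<bar>y\<bar> \<le> U"
  shows "\<bar>(Vvec N q i - v y i)\<^sup>2 - (Vvec N q i - v x i)\<^sup>2\<bar> \<le> 2 * bnd N q U * L * \<bar>y - x\<bar>"
proof -
  let ?a = "Vvec N q i - v y i" and ?b = "Vvec N q i - v x i"
  have "?a\<^sup>2 - ?b\<^sup>2 = (?a + ?b) * (v x i - v y i)" by (simp add: power2_eq_square algebra_simps)
  then have "\<bar>?a\<^sup>2 - ?b\<^sup>2\<bar> = \<bar>?a + ?b\<bar> * \<bar>v x i - v y i\<bar>" by (simp add: abs_mult)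
  also have "\<dots> \<le> (2 * bnd N q U) * (L * \<bar>y - x\<bar>)"
    using diff_le_bnd[OF assms(1), of N q i] diff_le_bnd[OF assms(2), of N q i] v_lip[of x i y]
    by (intro mult_mono) (auto simp: abs_minus_commute)
  finally show ?thesis by (simp add: mult.assoc)
qed

lemma gap_lipschitz:
  assumes "\<bar>x\<bar> \<le> U" "\<bar>y\<bar> \<le> U"
  shows "\<bar>gap N q y - gap N q x\<bar> \<le> 2 * (2 * bnd N q U * L) * \<bar>y - x\<bar>"
  unfolding gap_def
  by (rule wsum_lipschitz[of "\<lambda>t i. (Vvec N q i - v t i)\<^sup>2"]) (intro Bseqs sq_lipschitz assms)+

lemma gap_le:
  assumes "\<bar>t\<bar> \<le> U"
  shows "gap N q t \<le> 2 * (bnd N q U)\<^sup>2"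
proof -
  have "\<bar>wsum (\<lambda>i. (Vvec N q i - v t i)\<^sup>2)\<bar> \<le> 2 * (bnd N q U)\<^sup>2"
  proof (rule abs_wsum_le)
    show "\<bar>(Vvec N q i - v t i)\<^sup>2\<bar> \<le> (bnd N q U)\<^sup>2" for i
      using power_mono[OF diff_le_bnd[OF assms, of N q i] abs_ge_zero, of 2] by simp
  qed
  then show ?thesis by (simp add: gap_def)
qed

text \<open>The Lipschitz constant of the square grows with the time interval, so continuity is
  glued together from bounded open intervals.\<close>

lemma gap_continuous: "continuous_on A (gap N q)"
proof -
  have "continuous_on (\<Union>n::nat\<in>UNIV. {- real n<..<real n}) (gap N q)"
  proof (rule continuous_on_open_UN)
    fix n :: nat
    have "\<bar>2 * (2 * bnd N q n * L)\<bar>-lipschitz_on {- real n<..<real n} (gap N q)"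
      by (intro lipschitz_onI)
         (auto simp: dist_real_def intro!: order_trans[OF gap_lipschitz[of _ n]] mult_right_mono)
    then show "continuous_on {- real n<..<real n} (gap N q)" by (rule lipschitz_on_continuous_on)
  qed simp
  also have "(\<Union>n::nat\<in>UNIV. {- real n<..<real n}) = UNIV"
  proof (intro equalityI subsetI)
    fix x :: real
    obtain n where "\<bar>x\<bar> < real n" using reals_Archimedean2 by blast
    then show "x \<in> (\<Union>n::nat\<in>UNIV. {- real n<..<real n})" by (intro UN_I[of n]) auto
  qed auto
  finally show ?thesis by (rule continuous_on_subset) simp
qed

definition fluid_drift :: "real \<Rightarrow> nat \<Rightarrow> real" where
  "fluid_drift t j = lam * (v t (j - 1) - v t j) - (1 - p) * (v t j - v t (j + 1)) - gfl lam p (v t) j"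

lemma v_deriv_max:
  assumes "0 < t" "t \<notin> Z"
  shows "((\<lambda>s. v s i) has_real_derivative fluid_drift t (max 1 i)) (at t)"
proof (cases "i = 0")
  case True
  have "((\<lambda>s. 1 + v s 1) has_real_derivative fluid_drift t 1) (at t)"
    unfolding fluid_drift_def using v_deriv[OF assms, of 1] by (auto intro!: derivative_eq_intros)
  then show ?thesis using True v_0 by simp
next
  case False
  then show ?thesis using v_deriv[OF assms, of i] by (simp add: fluid_drift_def max_def)
qed

lemma Bseq_fluid_drift: "Bseq (\<lambda>i. fluid_drift t (max 1 i))"
proof -
  have "\<bar>gfl lam p (v t) i\<bar> \<le> 1" for i
    using lam p v_nonneg[of t "i - 1"] by (auto simp: gfl_def)
  then have "Bseq (gfl lam p (v t))" by (intro BseqI'[of _ 1]) auto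
  then have "Bseq (fluid_drift t)"
    unfolding fluid_drift_def by (intro Bseqs Bseq_subseq[OF Bseq_v])
  then show ?thesis by (rule Bseq_subseq)
qed

lemma Bseq_drift: "Bseq (\<lambda>i. drift lam p N q (max 1 i))"
proof -
  have "Bseq (\<lambda>i. of_bool (0 < Vvec N q i) :: real)" by (intro BseqI'[of _ 1]) auto
  then have "Bseq (drift lam p N q)"
    unfolding drift_def by (intro Bseqs Bseq_subseq[OF Bseq_Vvec])
  then show ?thesis by (rule Bseq_subseq)
qed

lemma gap_deriv:
  assumes "0 < t" "t \<notin> Z"
  shows "(gap N q has_real_derivative wsum (\<lambda>i. - 2 * ((Vvec N q i - v t i) * fluid_drift t (max 1 i)))) (at t)"
  unfolding gap_def[abs_def]
proof (rule wsum_has_derivative[where f="\<lambda>t i. (Vvec N q i - v t i)\<^sup>2" and d=1 and A="2 * bnd N q (\<bar>t\<bar> + 1) * L"])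
  show "Bseq (\<lambda>i. (Vvec N q i - v y i)\<^sup>2)" for y by (intro Bseqs)
  show "\<bar>(Vvec N q i - v y i)\<^sup>2 - (Vvec N q i - v t i)\<^sup>2\<bar> \<le> 2 * bnd N q (\<bar>t\<bar> + 1) * L * \<bar>y - t\<bar>" if "\<bar>y - t\<bar> < 1" for y i
    using that by (intro sq_lipschitz) auto
  show "((\<lambda>y. (Vvec N q i - v y i)\<^sup>2) has_real_derivative - 2 * ((Vvec N q i - v t i) * fluid_drift t (max 1 i))) (at t)" for i
    by (auto intro!: derivative_eq_intros v_deriv_max[OF assms] simp: power2_eq_square)
qed simp

text \<open>The first term is the time derivative of \<open>gap\<close> caused by the moving fluid
  path, the second is the first-order effect of the jumps per unit time. Only their sum is
  controlled, through the difference of the two drifts.\<close>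

lemma gap_one_sided:
  assumes N: "1 \<le> N"
  shows "wsum (\<lambda>i. - 2 * ((Vvec N q i - v t i) * fluid_drift t (max 1 i)))
     + 2 * wsum (\<lambda>i. (Vvec N q i - v t i) * drift lam p N q (max 1 i)) \<le> 15 * gap N q t"
proof -
  define d where "d i = Vvec N q i - v t i" for i
  have bd: "Bseq d" unfolding d_def[abs_def] by (intro Bseqs)
  \<comment> \<open>Coordinate 0 has no equation of its own. In both sequences it exceeds coordinate
    1 by exactly 1, so the differences at 0 and 1 coincide.\<close>
  have d0: "d i = d (max 1 i)" for i
    using Vvec_0[OF N, of q] v_0[of t] by (cases i) (auto simp: d_def max_def)
  have "wsum (\<lambda>i. - 2 * (d i * fluid_drift t (max 1 i))) + 2 * wsum (\<lambda>i. d i * drift lam p N q (max 1 i))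
     = wsum (\<lambda>i. - 2 * (d i * fluid_drift t (max 1 i))) + wsum (\<lambda>i. 2 * (d i * drift lam p N q (max 1 i)))"
    by (subst wsum_cmult) (intro Bseqs bd Bseq_drift refl)+
  also have "\<dots> = wsum (\<lambda>i. - 2 * (d i * fluid_drift t (max 1 i)) + 2 * (d i * drift lam p N q (max 1 i)))"
    by (rule wsum_add[symmetric]) (intro Bseqs bd Bseq_drift Bseq_fluid_drift)+
  also have "\<dots> = wsum (\<lambda>i. 2 * (d i * (drift lam p N q (max 1 i) - fluid_drift t (max 1 i))))"
    by (simp add: algebra_simps)
  also have "\<dots> \<le> wsum (\<lambda>i. 2 * ((d (max 1 i - 1))\<^sup>2 + (d (max 1 i + 1))\<^sup>2))"
  proof (rule wsum_mono)
    fix i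
    have "d (max 1 i) * (drift lam p N q (max 1 i) - fluid_drift t (max 1 i))
       \<le> (d (max 1 i - 1))\<^sup>2 + (d (max 1 i + 1))\<^sup>2"
      unfolding drift_def fluid_drift_def
      by (rule one_sided_lipschitz) (use lam p in \<open>auto simp: Vvec_nonneg v_nonneg d_def\<close>)
    then show "2 * (d i * (drift lam p N q (max 1 i) - fluid_drift t (max 1 i)))
       \<le> 2 * ((d (max 1 i - 1))\<^sup>2 + (d (max 1 i + 1))\<^sup>2)"
      using d0[of i] by simp
  qed (intro Bseqs bd Bseq_drift Bseq_fluid_drift Bseq_subseq[OF bd])+
  also have "\<dots> = 2 * wsum (\<lambda>i. (d (max 1 i - 1))\<^sup>2 + (d (max 1 i + 1))\<^sup>2)"
    by (rule wsum_cmult) (intro Bseqs Bseq_subseq[OF bd])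
  also have "\<dots> \<le> 15 * wsum (\<lambda>i. (d i)\<^sup>2)" by (rule wsum_neighbours_le[OF bd])
  finally show ?thesis by (simp add: gap_def d_def)
qed

text \<open>Expanding the square leaves a term linear in the jump and a remainder of at most 1/N^2
  per coordinate; the weights add up to 2.\<close>

lemma gap_step:
  assumes N: "1 \<le> N" and jmp: "\<And>i. \<bar>jump N q e i\<bar> \<le> 1"
  shows "gap N (step N e q) t \<le> (gap N q t + 2 / (real N)\<^sup>2)
     + 2 / real N * wsum (\<lambda>i. (Vvec N q i - v t i) * jump N q e i)"
proof -
  define d where "d i = Vvec N q i - v t i" for i
  have bd: "Bseq d" unfolding d_def[abs_def] by (intro Bseqs)
  have bj: "Bseq (jump N q e)" by (rule BseqI'[of _ 1]) (use jmp in auto)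
  have "gap N (step N e q) t \<le> wsum (\<lambda>i. ((d i)\<^sup>2 + 1 / (real N)\<^sup>2) + 2 / real N * (d i * jump N q e i))"
    unfolding gap_def
  proof (rule wsum_mono)
    fix i
    have "Vvec N (step N e q) i - v t i = d i + jump N q e i / real N"
      using N by (simp add: jump_def d_def)
    moreover have "(jump N q e i)\<^sup>2 \<le> 1" using jmp[of i] by (simp add: abs_square_le_1)
    then have "(jump N q e i)\<^sup>2 / (real N)\<^sup>2 \<le> 1 / (real N)\<^sup>2" by (intro divide_right_mono) auto
    ultimately show "(Vvec N (step N e q) i - v t i)\<^sup>2 \<le> ((d i)\<^sup>2 + 1 / (real N)\<^sup>2) + 2 / real N * (d i * jump N q e i)"
      by (simp add: power2_sum power_divide algebra_simps)
  qed (intro Bseqs bd bj)+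
  also have "\<dots> = wsum (\<lambda>i. (d i)\<^sup>2 + 1 / (real N)\<^sup>2) + wsum (\<lambda>i. 2 / real N * (d i * jump N q e i))"
    by (rule wsum_add) (intro Bseqs bd bj)+
  also have "wsum (\<lambda>i. (d i)\<^sup>2 + 1 / (real N)\<^sup>2) = gap N q t + 2 / (real N)\<^sup>2"
    by (subst wsum_add) (auto intro!: Bseqs bd simp: wsum_const gap_def d_def)
  also have "wsum (\<lambda>i. 2 / real N * (d i * jump N q e i)) = 2 / real N * wsum (\<lambda>i. d i * jump N q e i)"
    by (rule wsum_cmult) (intro Bseqs bd bj)
  finally show ?thesis by (simp add: d_def)
qed

lemma mean_ev_gap:
  assumes N: "1 \<le> N" and len: "length q = N"
  shows "mean_ev lam p N (\<lambda>e. gap N (step N e q) t) \<le> gap N q t + 2 / (real N)\<^sup>2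
     + 2 / (real N * (lam + 1)) * wsum (\<lambda>i. (Vvec N q i - v t i) * drift lam p N q (max 1 i))"
proof -
  let ?d = "\<lambda>i. Vvec N q i - v t i"
  note j1 = abs_jump_le[OF N len]
  have b: "Bseq (\<lambda>i. ?d i * jump N q e i)" if "\<And>i. \<bar>jump N q e i\<bar> \<le> 1" for e
  proof -
    have "Bseq (jump N q e)" by (rule BseqI'[of _ 1]) (use that in auto)
    then show ?thesis by (intro Bseqs)
  qed
  have "mean_ev lam p N (\<lambda>e. gap N (step N e q) t)
     \<le> mean_ev lam p N (\<lambda>e. (gap N q t + 2 / (real N)\<^sup>2) + 2 / real N * wsum (\<lambda>i. ?d i * jump N q e i))"
    by (rule mean_ev_mono[OF lam(1) p]) (rule gap_step[OF N]; simp add: j1 del: step.simps)+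
  also have "\<dots> = (gap N q t + 2 / (real N)\<^sup>2) + 2 / real N * mean_ev lam p N (\<lambda>e. wsum (\<lambda>i. ?d i * jump N q e i))"
    by (rule mean_ev_affine[OF lam(1) N])
  also have "mean_ev lam p N (\<lambda>e. wsum (\<lambda>i. ?d i * jump N q e i)) = wsum (\<lambda>i. mean_ev lam p N (\<lambda>e. ?d i * jump N q e i))"
    by (rule mean_ev_wsum) (auto intro!: b j1)
  also have "\<dots> = wsum (\<lambda>i. 1 / (lam + 1) * (?d i * drift lam p N q (max 1 i)))"
    using mean_ev_affine[OF lam(1) N, of p 0] mean_ev_jump[OF lam(1) N len] by simp
  also have "\<dots> = 1 / (lam + 1) * wsum (\<lambda>i. ?d i * drift lam p N q (max 1 i))"
    by (rule wsum_cmult) (intro Bseqs Bseq_drift)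
  finally show ?thesis by simp
qed

lemma mean_ev_cmult: "1 \<le> N \<Longrightarrow> mean_ev lam p N (\<lambda>e. c * f e) = c * mean_ev lam p N f"
  using mean_ev_affine[OF lam(1), of N p 0 c f] by simp

lemma one_step:
  assumes N: "1 \<le> N" and len: "length q = N" and t: "0 \<le> t"
  shows "(\<integral>\<^sup>+u. (\<integral>\<^sup>+e. ennreal (exp (- (15 * (t + u))) * gap N (step N e q) (t + u)) \<partial>measure_pmf (ev_pmf lam p N))
       \<partial>density lborel (exponential_density (real N * (lam + 1))))
     \<le> ennreal (exp (- (15 * t)) * gap N q t + 2 / (real N)\<^sup>2)"
proof -
  define r where "r = real N * (lam + 1)"
  have r: "0 < r" using N lam by (simp add: r_def)
  define E where "E u = exp (- (15 * (t + u)))" for u :: real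
  define k where "k u = mean_ev lam p N (\<lambda>e. E u * gap N (step N e q) (t + u))" for u
  \<comment> \<open>The constant is added undiscounted: it dominates the second-order error at every
    delay since \<open>E u\<close> is at most 1 there, and its derivative is zero.\<close>
  define \<psi> where "\<psi> u = E u * gap N q (t + u) + 2 / (real N)\<^sup>2" for u
  have E: "0 < E u" for u by (simp add: E_def)
  have E1: "E u \<le> 1" if "0 \<le> u" for u using that t by (simp add: E_def)
  have EL: "\<bar>E y - E x\<bar> \<le> 15 * \<bar>y - x\<bar>" if "0 \<le> x" "0 \<le> y" for x y
    using exp_neg_lipschitz[of 15 "t + x" "t + y"] that t by (simp add: E_def)
  have k_nonneg: "0 \<le> k u" for u
  proof -
    have "mean_ev lam p N (\<lambda>_. 0 + 0 * 0) \<le> k u"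
      unfolding k_def by (rule mean_ev_mono[OF lam(1) p]) (auto simp: E gap_nonneg less_imp_le simp del: step.simps)
    then show ?thesis by (subst (asm) mean_ev_affine[OF lam(1) N]) simp
  qed
  have "(\<integral>\<^sup>+u. ennreal (k u) \<partial>density lborel (exponential_density r)) \<le> ennreal (\<psi> 0)"
  proof (rule nn_integral_exponential_le[OF r])
    show "0 \<le> \<psi> u" for u using E[of u] gap_nonneg by (simp add: \<psi>_def)
    show "0 \<le> k u" for u by (rule k_nonneg)
    have contg: "continuous_on UNIV (\<lambda>u. gap N q' (t + u))" for q'
      by (rule continuous_on_compose2[OF gap_continuous[of UNIV]]) (auto intro!: continuous_intros)
    show "continuous_on UNIV k"
      unfolding k_def mean_ev_def E_def by (intro continuous_intros contg) (use N lam in auto)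
    \<comment> \<open>The delay u is measured from t, so the exceptional times are shifted by
      -t.\<close>
    show "negligible ((+) (- t) ` Z)" by (rule negligible_translation[OF Z])
    show "\<exists>B. \<forall>u\<in>{0..U}. \<bar>\<psi> u\<bar> \<le> B" for U
    proof (intro exI ballI)
      fix u assume u: "u \<in> {0..U}"
      have "gap N q (t + u) \<le> 2 * (bnd N q (t + U))\<^sup>2" using u t by (intro gap_le) auto
      moreover have "E u * gap N q (t + u) \<le> 1 * gap N q (t + u)"
        using E1[of u] u gap_nonneg by (intro mult_right_mono) auto
      moreover have "0 \<le> E u * gap N q (t + u)" using E[of u] gap_nonneg by simp
      ultimately show "\<bar>\<psi> u\<bar> \<le> 2 * (bnd N q (t + U))\<^sup>2 + 2 / (real N)\<^sup>2" by (simp add: \<psi>_def)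
    qed
    show "\<exists>B. \<forall>x\<in>{0..U}. \<forall>y\<in>{0..U}. \<bar>\<psi> y - \<psi> x\<bar> \<le> B * \<bar>y - x\<bar>" for U
    proof (intro exI ballI)
      fix x y assume xy: "x \<in> {0..U}" "y \<in> {0..U}"
      have "\<bar>E y * gap N q (t + y) - E x * gap N q (t + x)\<bar>
         \<le> (1 * (2 * (2 * bnd N q (t + U) * L)) + 15 * (2 * (bnd N q (t + U))\<^sup>2)) * \<bar>y - x\<bar>"
      proof (rule lipschitz_mult_bounded[where S="{0..U}"])
        show "\<bar>E x\<bar> \<le> 1" if "x \<in> {0..U}" for x using E1[of x] E[of x] that by auto
        show "\<bar>gap N q (t + x)\<bar> \<le> 2 * (bnd N q (t + U))\<^sup>2" if "x \<in> {0..U}" for x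
          using gap_le[of "t + x" "t + U" N q] gap_nonneg[of N q "t + x"] that t by auto
        show "\<bar>gap N q (t + y) - gap N q (t + x)\<bar> \<le> 2 * (2 * bnd N q (t + U) * L) * \<bar>y - x\<bar>"
          if "x \<in> {0..U}" "y \<in> {0..U}" for x y
          using gap_lipschitz[of "t + x" "t + U" "t + y" N q] that t by auto
      qed (use EL xy in auto)
      then show "\<bar>\<psi> y - \<psi> x\<bar> \<le> (1 * (2 * (2 * bnd N q (t + U) * L)) + 15 * (2 * (bnd N q (t + U))\<^sup>2)) * \<bar>y - x\<bar>"
        by (simp add: \<psi>_def)
    qed
    fix x assume x: "0 < x" "x \<notin> (+) (- t) ` Z"
    have "t + x \<notin> Z"
    proof
      assume "t + x \<in> Z"
      then have "- t + (t + x) \<in> (+) (- t) ` Z" by (rule imageI)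
      then show False using x by simp
    qed
    define W where "W = wsum (\<lambda>i. (Vvec N q i - v (t + x) i) * drift lam p N q (max 1 i))"
    define D where "D = wsum (\<lambda>i. - 2 * ((Vvec N q i - v (t + x) i) * fluid_drift (t + x) (max 1 i)))"
    have "(gap N q has_real_derivative D) (at (t + x))"
      unfolding D_def by (rule gap_deriv) (use x t \<open>t + x \<notin> Z\<close> in auto)
    then have g: "((\<lambda>u. gap N q (t + u)) has_real_derivative D) (at x)"
      unfolding add.commute[of t] by (rule DERIV_shift[THEN iffD1])
    have e: "(E has_real_derivative - 15 * E x) (at x)"
      unfolding E_def by (auto intro!: derivative_eq_intros)
    have d: "(\<psi> has_real_derivative (E x * (D - 15 * gap N q (t + x)))) (at x)"
      unfolding \<psi>_def using DERIV_add[OF DERIV_mult[OF e g] DERIV_const[of "2 / (real N)\<^sup>2"]]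
      by (simp add: algebra_simps)
    have "k x = E x * mean_ev lam p N (\<lambda>e. gap N (step N e q) (t + x))"
      unfolding k_def by (rule mean_ev_cmult[OF N])
    also have "\<dots> \<le> E x * (gap N q (t + x) + 2 / (real N)\<^sup>2 + 2 / r * W)"
      unfolding W_def r_def by (rule mult_left_mono[OF mean_ev_gap[OF N len] less_imp_le[OF E]])
    also have "\<dots> = E x * gap N q (t + x) + E x * (2 / (real N)\<^sup>2) + E x * (2 / r * W)" by (simp add: algebra_simps)
    also have "E x * (2 / (real N)\<^sup>2) \<le> 1 * (2 / (real N)\<^sup>2)"
      using E1[of x] x by (intro mult_right_mono) auto
    finally have "k x \<le> \<psi> x + E x * (2 / r * W)" by (simp add: \<psi>_def)
    then have "r * k x \<le> r * (\<psi> x + E x * (2 / r * W))" using r by (intro mult_left_mono) auto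
    \<comment> \<open>The jump size 1/N cancels against the event rate: the mean linear term per
      event is 2/r times \<open>W\<close>.\<close>
    also have "\<dots> = r * \<psi> x + E x * (2 * W)" using r by (simp add: algebra_simps)
    finally have 1: "r * k x \<le> r * \<psi> x + E x * (2 * W)" .
    have "D - 15 * gap N q (t + x) \<le> - (2 * W)"
      using gap_one_sided[OF N, of q "t + x"] by (simp add: D_def W_def)
    then have "E x * (D - 15 * gap N q (t + x)) \<le> E x * - (2 * W)" using E[of x] by (intro mult_left_mono) auto
    with 1 show "\<exists>D. (\<psi> has_real_derivative D) (at x) \<and> D \<le> r * \<psi> x - r * k x"
      using d by (intro exI[of _ "E x * (D - 15 * gap N q (t + x))"]) auto
  qed
  also have "ennreal (\<psi> 0) = ennreal (exp (- (15 * t)) * gap N q t + 2 / (real N)\<^sup>2)"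
    by (simp add: \<psi>_def E_def)
  finally have "(\<integral>\<^sup>+u. ennreal (k u) \<partial>density lborel (exponential_density r))
      \<le> ennreal (exp (- (15 * t)) * gap N q t + 2 / (real N)\<^sup>2)" .
  moreover have "(\<integral>\<^sup>+e. ennreal (E u * gap N (step N e q) (t + u)) \<partial>measure_pmf (ev_pmf lam p N)) = ennreal (k u)" for u
    unfolding k_def
    by (rule nn_integral_ev_pmf[OF lam(1) p N]) (rule mult_nonneg_nonneg[OF less_imp_le[OF E] gap_nonneg])
  ultimately show ?thesis unfolding E_def r_def by (simp only:)
qed

end

section \<open>Maximal inequality\<close>

instance event :: countable by countable_datatype

abbreviation marks :: "(real \<times> event) measure" where
  "marks \<equiv> borel \<Otimes>\<^sub>M count_space UNIV"

abbreviation ev_law :: "real \<Rightarrow> real \<Rightarrow> nat \<Rightarrow> (real \<times> event) measure" where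
  "ev_law lam p N \<equiv> density lborel (exponential_density (real N * (lam + 1))) \<Otimes>\<^sub>M measure_pmf (ev_pmf lam p N)"

lemma sets_ev_law: "sets (ev_law lam p N) = sets marks"
  by (rule sets_pair_measure_cong) auto

lemma sets_drive [measurable_cong]: "sets (drive lam p N) = sets (stream_space marks)"
  unfolding drive_def by (rule sets_stream_space_cong[OF sets_ev_law])

lemma space_drive: "space (drive lam p N) = UNIV"
proof -
  have "space (drive lam p N) = space (stream_space marks)" by (rule sets_eq_imp_space_eq[OF sets_drive])
  then show ?thesis by (simp add: space_stream_space space_pair_measure)
qed

lemma prob_space_ev_law:
  assumes "0 \<le> lam" "1 \<le> N"
  shows "prob_space (ev_law lam p N)"
proof -
  interpret A: prob_space "density lborel (exponential_density (real N * (lam + 1)))"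
    using assms by (intro prob_space_exponential_density) auto
  interpret P: pair_prob_space "density lborel (exponential_density (real N * (lam + 1)))" "measure_pmf (ev_pmf lam p N)" ..
  show ?thesis by (rule P.prob_space_axioms)
qed

lemma measurable_step:
  assumes [measurable]: "e \<in> M \<rightarrow>\<^sub>M count_space UNIV" "q \<in> M \<rightarrow>\<^sub>M count_space UNIV"
  shows "(\<lambda>x. step N (e x) (q x)) \<in> M \<rightarrow>\<^sub>M count_space UNIV"
proof (rule measurable_compose_countable[where f="\<lambda>e x. step N e (q x)" and g=e])
  show "(\<lambda>x. step N e (q x)) \<in> M \<rightarrow>\<^sub>M count_space UNIV" for e
    by (rule measurable_compose[OF assms(2)]) simp
qed simp

text \<open>\<open>hit\<close> says that the chain started at time t in state q, before leaving the time interval up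
 to T, gets far from the fluid path or waits longer than \<open>\<delta>\<close> for an event, or that it
 fails to leave the interval within n events.\<close>

primrec (in fluid) hit :: "nat \<Rightarrow> real \<Rightarrow> real \<Rightarrow> real \<Rightarrow> nat \<Rightarrow> real \<Rightarrow> nat list \<Rightarrow> (real \<times> event) stream \<Rightarrow> bool" where
  "hit N T a \<delta> 0 t q \<omega> \<longleftrightarrow> t \<le> T"
| "hit N T a \<delta> (Suc n) t q \<omega> \<longleftrightarrow> t \<le> T \<and>
     (a \<le> exp (- (15 * t)) * gap N q t \<or> fst (shd \<omega>) < 0 \<or> \<delta> < fst (shd \<omega>)
      \<or> hit N T a \<delta> n (t + fst (shd \<omega>)) (step N (snd (shd \<omega>)) q) (stl \<omega>))"

text \<open>The Laplace transform of the waiting time at 1, which is the mean factor by which one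
  event shrinks exp(-t).\<close>

lemma nn_integral_exponential_exp:
  assumes "0 < r"
  shows "(\<integral>\<^sup>+u. ennreal (exp (- u)) \<partial>density lborel (exponential_density r)) = ennreal (r / (r + 1))"
proof -
  have "(\<integral>\<^sup>+u. ennreal (exp (- u)) \<partial>density lborel (exponential_density r))
     = (\<integral>\<^sup>+u. ennreal (exponential_density r u) * ennreal (exp (- u)) \<partial>lborel)"
    by (rule nn_integral_density) auto
  also have "\<dots> = (\<integral>\<^sup>+u. ennreal (r / (r + 1)) * ennreal (erlang_density 0 (r + 1) u * u ^ 0) \<partial>lborel)"
  proof (intro nn_integral_cong)
    fix u :: real
    show "ennreal (exponential_density r u) * ennreal (exp (- u))
      = ennreal (r / (r + 1)) * ennreal (erlang_density 0 (r + 1) u * u ^ 0)"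
    proof (cases "u < 0")
      case False
      have "r * exp (- u * r) * exp (- u) = r / (r + 1) * ((r + 1) * exp (- u * (r + 1)))"
      proof -
        have "exp (- u * r) * exp (- u) = exp (- u * (r + 1))" by (simp add: algebra_simps flip: exp_add)
        then show ?thesis using assms by simp
      qed
      then show ?thesis using False assms
        by (simp add: exponential_density_def flip: ennreal_mult)
    qed (simp add: exponential_density_def)
  qed
  also have "\<dots> = ennreal (r / (r + 1)) * (\<integral>\<^sup>+u. ennreal (erlang_density 0 (r + 1) u * u ^ 0) \<partial>lborel)"
    by (rule nn_integral_cmult) auto
  also have "\<dots> = ennreal (r / (r + 1))"
    using assms by (subst nn_integral_erlang_ith_moment) auto
  finally show ?thesis .
qed

text \<open>Markov's inequality for the second moment. A first moment would give only order 1/N per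
  event, too much for the order N events before T.\<close>

lemma exponential_tail_le:
  assumes "0 < r" "0 < \<delta>"
  shows "(\<integral>\<^sup>+u. indicator {\<delta><..} u \<partial>density lborel (exponential_density r)) \<le> ennreal (2 / (r * \<delta>)\<^sup>2)"
proof -
  have "(\<integral>\<^sup>+u. indicator {\<delta><..} u \<partial>density lborel (exponential_density r))
     = (\<integral>\<^sup>+u. ennreal (exponential_density r u) * indicator {\<delta><..} u \<partial>lborel)"
    by (rule nn_integral_density) auto
  also have "\<dots> \<le> (\<integral>\<^sup>+u. ennreal (1 / \<delta>\<^sup>2) * ennreal (erlang_density 0 r u * u ^ 2) \<partial>lborel)"
  proof (intro nn_integral_mono)
    fix u :: real
    have d: "0 \<le> exponential_density r u" using exponential_density_nonneg[OF assms(1)] .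
    show "ennreal (exponential_density r u) * indicator {\<delta><..} u
      \<le> ennreal (1 / \<delta>\<^sup>2) * ennreal (erlang_density 0 r u * u ^ 2)"
    proof (cases "\<delta> < u")
      case True
      then have "1 \<le> 1 / \<delta>\<^sup>2 * u\<^sup>2" using assms by (simp add: power_mono)
      then have "exponential_density r u * 1 \<le> exponential_density r u * (1 / \<delta>\<^sup>2 * u\<^sup>2)"
        using d by (rule mult_left_mono)
      then have "exponential_density r u \<le> 1 / \<delta>\<^sup>2 * (erlang_density 0 r u * u ^ 2)" by (simp add: ac_simps)
      then show ?thesis using True d by (simp add: ennreal_leI flip: ennreal_mult)
    qed simp
  qed
  also have "\<dots> = ennreal (1 / \<delta>\<^sup>2) * (\<integral>\<^sup>+u. ennreal (erlang_density 0 r u * u ^ 2) \<partial>lborel)"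
    by (rule nn_integral_cmult) auto
  also have "\<dots> = ennreal (2 / (r * \<delta>)\<^sup>2)"
    using assms by (subst nn_integral_erlang_ith_moment) (auto simp: power_mult_distrib simp flip: ennreal_mult)
  finally show ?thesis .
qed

context fluid
begin

lemma measurable_gap [measurable (raw)]:
  assumes [measurable]: "q \<in> M \<rightarrow>\<^sub>M count_space UNIV" "t \<in> borel_measurable M"
  shows "(\<lambda>x. gap N (q x) (t x)) \<in> borel_measurable M"
proof (rule measurable_compose_countable[where f="\<lambda>q x. gap N q (t x)" and g=q])
  show "(\<lambda>x. gap N q (t x)) \<in> borel_measurable M" for q
    by (rule measurable_compose[OF assms(2)]) (rule borel_measurable_continuous_onI[OF gap_continuous])
qed simp

text \<open>Time, state and stream are arbitrary measurable functions because the recursion changes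
  all three.\<close>

lemma measurable_hit:
  assumes [measurable]: "t \<in> borel_measurable M" "q \<in> M \<rightarrow>\<^sub>M count_space UNIV" "\<omega> \<in> M \<rightarrow>\<^sub>M stream_space marks"
  shows "Measurable.pred M (\<lambda>x. hit N T a \<delta> n (t x) (q x) (\<omega> x))"
  using assms
proof (induction n arbitrary: t q \<omega>)
  case 0
  note 0[measurable]
  show ?case by simp
next
  case (Suc n)
  note Suc.prems[measurable]
  have [measurable]: "(\<lambda>x. shd (\<omega> x)) \<in> M \<rightarrow>\<^sub>M marks" "(\<lambda>x. stl (\<omega> x)) \<in> M \<rightarrow>\<^sub>M stream_space marks"
    by measurable
  have [measurable]: "Measurable.pred M (\<lambda>x. hit N T a \<delta> n (t x + fst (shd (\<omega> x))) (step N (snd (shd (\<omega> x))) (q x)) (stl (\<omega> x)))"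
    by (intro Suc.IH measurable_step) measurable
  show ?case by simp
qed

definition rate :: "nat \<Rightarrow> real" where "rate N = real N * (lam + 1)"

text \<open>One event loses at most \<open>2 / (N \<delta>)^2\<close> for a long wait and
  \<open>2 / (a N^2)\<close> for the step error. The compensator \<open>cost / (N a)\<close> times
  exp(-t) shrinks on average by its 1/(rate + 1) part, hence before T by at least exp(-T)/(3N) times
  its coefficient. Balancing the two gives the factor 3 exp(T).\<close>

definition cost :: "real \<Rightarrow> real \<Rightarrow> real \<Rightarrow> real" where
  "cost T a \<delta> = 3 * exp T * (2 * a / \<delta>\<^sup>2 + 2)"

text \<open>Three contributions: Markov's bound for being far from the path, the compensator for the
  accumulated errors, and the Chernoff bound for n further events before T, since the mean of exp(T
  - t - S) for a sum S of n waiting times is exp(T - t) (r/(r + 1))^n.\<close>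

definition hit_bd :: "nat \<Rightarrow> real \<Rightarrow> real \<Rightarrow> real \<Rightarrow> nat \<Rightarrow> real \<Rightarrow> nat list \<Rightarrow> real" where
  "hit_bd N T a \<delta> n t q = 1 / a * (exp (- (15 * t)) * gap N q t)
     + (cost T a \<delta> / (real N * a) + exp T * (rate N / (rate N + 1)) ^ n) * exp (- t)"

lemma rate: assumes "1 \<le> N" shows "0 < rate N" "real N \<le> rate N" "rate N + 1 \<le> 3 * real N"
proof -
  have n: "1 \<le> real N" using assms by simp
  show "0 < rate N" using n lam by (simp add: rate_def)
  show "real N \<le> rate N" using n lam mult_left_mono[of 1 "lam + 1" "real N"] by (simp add: rate_def)
  have "real N * (lam + 1) \<le> real N * 2" using lam by (intro mult_left_mono) auto
  then show "rate N + 1 \<le> 3 * real N" using n unfolding rate_def by linarith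
qed

lemma hit_bd_step:
  assumes N: "1 \<le> N" and len: "length q = N" and t: "0 \<le> t" "t \<le> T" and a: "0 < a" and \<delta>: "0 < \<delta>"
  shows "(\<integral>\<^sup>+u. (\<integral>\<^sup>+e. indicator {\<delta><..} u + ennreal (hit_bd N T a \<delta> n (t + u) (step N e q)) \<partial>measure_pmf (ev_pmf lam p N))
     \<partial>density lborel (exponential_density (rate N))) \<le> ennreal (hit_bd N T a \<delta> (Suc n) t q)"
proof -
  define r where "r = rate N"
  have r: "0 < r" "real N \<le> r" "r + 1 \<le> 3 * real N" using rate[OF N] by (simp_all add: r_def)
  define \<Phi> where "\<Phi> u e = exp (- (15 * (t + u))) * gap N (step N e q) (t + u)" for u e
  define D where "D = density lborel (\<lambda>x. ennreal (exponential_density r x))"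
  define P where "P = measure_pmf (ev_pmf lam p N)"
  define c where "c = (cost T a \<delta> / (real N * a) + exp T * (r / (r + 1)) ^ n) * exp (- t)"
  have cost0: "0 \<le> cost T a \<delta>" using a by (simp add: cost_def)
  have c: "0 \<le> c" using cost0 a r by (simp add: c_def)
  have \<Phi>0: "0 \<le> \<Phi> u e" for u e by (simp add: \<Phi>_def gap_nonneg)
  have [measurable]: "(\<lambda>u. \<Phi> u e) \<in> borel_measurable D" for e
    unfolding \<Phi>_def D_def by measurable
  have eq: "ennreal (hit_bd N T a \<delta> n (t + u) (step N e q)) = ennreal (1 / a) * ennreal (\<Phi> u e) + ennreal c * ennreal (exp (- u))" for u e
  proof -
    have "hit_bd N T a \<delta> n (t + u) (step N e q) = 1 / a * \<Phi> u e + c * exp (- u)"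
    proof -
      have "exp (- (t + u)) = exp (- t) * exp (- u)" by (simp flip: exp_add)
      then show ?thesis unfolding hit_bd_def \<Phi>_def c_def r_def by (simp only: mult.assoc)
    qed
    then show ?thesis using a c \<Phi>0[of u e] by (simp flip: ennreal_mult ennreal_plus)
  qed
  have m: "(\<lambda>u. \<integral>\<^sup>+e. ennreal (\<Phi> u e) \<partial>P) \<in> borel_measurable D"
  proof -
    have "(\<lambda>u. \<integral>\<^sup>+e. ennreal (\<Phi> u e) \<partial>P) = (\<lambda>u. ennreal (mean_ev lam p N (\<Phi> u)))"
      unfolding P_def by (intro ext nn_integral_ev_pmf lam p N \<Phi>0)
    then show ?thesis unfolding mean_ev_def by simp
  qed
  have "(\<integral>\<^sup>+u. (\<integral>\<^sup>+e. indicator {\<delta><..} u + ennreal (hit_bd N T a \<delta> n (t + u) (step N e q)) \<partial>P) \<partial>D)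
     = (\<integral>\<^sup>+u. indicator {\<delta><..} u + (ennreal (1 / a) * (\<integral>\<^sup>+e. ennreal (\<Phi> u e) \<partial>P) + ennreal c * ennreal (exp (- u))) \<partial>D)"
    unfolding eq P_def
    by (intro nn_integral_cong) (simp add: nn_integral_add nn_integral_cmult measure_pmf.emeasure_space_1)
  also have "\<dots> = (\<integral>\<^sup>+u. indicator {\<delta><..} u \<partial>D) + (ennreal (1 / a) * (\<integral>\<^sup>+u. (\<integral>\<^sup>+e. ennreal (\<Phi> u e) \<partial>P) \<partial>D)
       + ennreal c * (\<integral>\<^sup>+u. ennreal (exp (- u)) \<partial>D))"
    using m by (simp add: nn_integral_add nn_integral_cmult D_def)
  also have "\<dots> \<le> ennreal (2 / (r * \<delta>)\<^sup>2) + (ennreal (1 / a) * ennreal (exp (- (15 * t)) * gap N q t + 2 / (real N)\<^sup>2)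
       + ennreal c * ennreal (r / (r + 1)))"
    unfolding D_def P_def \<Phi>_def nn_integral_exponential_exp[OF r(1)]
    by (intro add_mono mult_left_mono order_refl exponential_tail_le r \<delta> one_step[OF N len t(1), folded rate_def, folded r_def]) auto
  also have "\<dots> = ennreal (2 / (r * \<delta>)\<^sup>2 + (1 / a * (exp (- (15 * t)) * gap N q t + 2 / (real N)\<^sup>2) + c * (r / (r + 1))))"
  proof -
    have "0 \<le> exp (- (15 * t)) * gap N q t + 2 / (real N)\<^sup>2" using gap_nonneg by simp
    then show ?thesis using a c r by (simp flip: ennreal_mult ennreal_plus)
  qed
  also have "\<dots> \<le> ennreal (hit_bd N T a \<delta> (Suc n) t q)"
  proof (rule ennreal_leI)
    have N0: "0 < real N" using N by simp
    have "(real N * \<delta>)\<^sup>2 \<le> (r * \<delta>)\<^sup>2" using r \<delta> by (intro power_mono mult_right_mono) auto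
    then have 1: "2 / (r * \<delta>)\<^sup>2 \<le> 2 / (real N * \<delta>)\<^sup>2" using N0 \<delta> r by (intro divide_left_mono) auto
    have "2 / (real N * \<delta>)\<^sup>2 + 1 / a * (2 / (real N)\<^sup>2) = (2 * a / \<delta>\<^sup>2 + 2) / (a * (real N)\<^sup>2)"
      using N0 a \<delta> by (simp add: field_simps power_mult_distrib)
    also have "\<dots> = cost T a \<delta> / (real N * a) * (exp (- T) * (1 / (3 * real N)))"
      using N0 a by (simp add: cost_def field_simps power2_eq_square exp_minus)
    also have "\<dots> \<le> cost T a \<delta> / (real N * a) * (exp (- t) * (1 / (r + 1)))"
      using cost0 N0 a t r by (intro mult_left_mono mult_mono divide_left_mono) auto
    finally have 2: "2 / (real N * \<delta>)\<^sup>2 + 1 / a * (2 / (real N)\<^sup>2) \<le> cost T a \<delta> / (real N * a) * exp (- t) * (1 / (r + 1))"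
      by (simp add: mult.assoc)
    \<comment> \<open>The share that exp(-t) loses on average in one event; this is what pays for
      the errors.\<close>
    have 3: "1 / (r + 1) = 1 - r / (r + 1)" using r by (simp add: field_simps)
    have "c * (r / (r + 1)) = cost T a \<delta> / (real N * a) * exp (- t) * (r / (r + 1)) + exp T * (r / (r + 1)) ^ Suc n * exp (- t)"
      by (simp add: c_def algebra_simps)
    moreover have "hit_bd N T a \<delta> (Suc n) t q = 1 / a * (exp (- (15 * t)) * gap N q t)
      + cost T a \<delta> / (real N * a) * exp (- t) + exp T * (r / (r + 1)) ^ Suc n * exp (- t)"
      unfolding hit_bd_def r_def[symmetric] by (simp only: distrib_right add.assoc)
    moreover have "cost T a \<delta> / (real N * a) * exp (- t) * (1 / (r + 1)) + cost T a \<delta> / (real N * a) * exp (- t) * (r / (r + 1))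
       = cost T a \<delta> / (real N * a) * exp (- t)"
      unfolding 3 by (simp only: right_diff_distrib)
    moreover have "1 / a * (exp (- (15 * t)) * gap N q t + 2 / (real N)\<^sup>2) = 1 / a * (exp (- (15 * t)) * gap N q t) + 1 / a * (2 / (real N)\<^sup>2)"
      by (rule distrib_left)
    ultimately show "2 / (r * \<delta>)\<^sup>2 + (1 / a * (exp (- (15 * t)) * gap N q t + 2 / (real N)\<^sup>2) + c * (r / (r + 1)))
      \<le> hit_bd N T a \<delta> (Suc n) t q"
      using 1 2 by linarith
  qed
  finally show ?thesis by (simp add: D_def P_def r_def)
qed

text \<open>Conditioning on the first event. If the state is already far the bound exceeds 1;
  otherwise the induction hypothesis is averaged by \<open>hit_bd_step\<close>.\<close>

lemma emeasure_hit_le: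
  assumes N: "1 \<le> N" and len: "length q = N" and t: "0 \<le> t" and a: "0 < a" and \<delta>: "0 < \<delta>"
  shows "emeasure (drive lam p N) {\<omega>. hit N T a \<delta> n t q \<omega>} \<le> ennreal (hit_bd N T a \<delta> n t q)"
  using len t
proof (induction n arbitrary: t q)
  case (0 t q)
  interpret E: prob_space "ev_law lam p N" by (rule prob_space_ev_law[OF lam(1) N])
  interpret Dr: prob_space "drive lam p N" unfolding drive_def by (rule E.prob_space_stream_space)
  show ?case
  proof (cases "t \<le> T")
    case True
    \<comment> \<open>With no events left the chain counts as bad, so the bound has to reach 1; the
      Chernoff term does this alone.\<close>
    have "1 \<le> exp (T - t)" using True by simp
    also have "exp (T - t) = exp T * exp (- t)" by (simp flip: exp_add)
    also have "\<dots> \<le> hit_bd N T a \<delta> 0 t q"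
      using a N gap_nonneg[of N q t] by (simp add: hit_bd_def cost_def algebra_simps)
    finally have "1 \<le> hit_bd N T a \<delta> 0 t q" .
    then show ?thesis using Dr.emeasure_le_1 by (metis ennreal_1 ennreal_leI order_trans)
  qed simp
next
  case (Suc n t q)
  interpret E: prob_space "ev_law lam p N" by (rule prob_space_ev_law[OF lam(1) N])
  interpret Dr: prob_space "drive lam p N" unfolding drive_def by (rule E.prob_space_stream_space)
  have m: "{\<omega>. hit N T a \<delta> n t q \<omega>} \<in> sets (drive lam p N)" for n t q
  proof -
    have "Measurable.pred (drive lam p N) (\<lambda>\<omega>. hit N T a \<delta> n t q \<omega>)"
      by (rule measurable_hit) (simp_all add: measurable_ident_sets[OF sets_drive])
    then show ?thesis by (simp add: pred_def space_drive)
  qed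
  consider "T < t" | "t \<le> T" "a \<le> exp (- (15 * t)) * gap N q t" | "t \<le> T" "exp (- (15 * t)) * gap N q t < a" by linarith
  then show ?case
  proof cases
    case 1
    then have "{\<omega>. hit N T a \<delta> (Suc n) t q \<omega>} = {}" by auto
    then show ?thesis by (simp only: emeasure_empty) simp
  next
    case 2
    have "1 \<le> 1 / a * (exp (- (15 * t)) * gap N q t)" using 2 a by (simp add: field_simps)
    also have "\<dots> \<le> hit_bd N T a \<delta> (Suc n) t q"
      using a N rate[OF N] by (simp add: hit_bd_def cost_def)
    finally have "1 \<le> hit_bd N T a \<delta> (Suc n) t q" .
    then show ?thesis using Dr.emeasure_le_1 by (metis ennreal_1 ennreal_leI order_trans)
  next
    case 3
    define D where "D = density lborel (\<lambda>x. ennreal (exponential_density (real N * (lam + 1)) x))"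
    define P where "P = measure_pmf (ev_pmf lam p N)"
    have law: "ev_law lam p N = D \<Otimes>\<^sub>M P" by (simp add: D_def P_def)
    have dr: "stream_space (D \<Otimes>\<^sub>M P) = drive lam p N" by (simp add: drive_def D_def P_def)
    have "emeasure (drive lam p N) {\<omega>. hit N T a \<delta> (Suc n) t q \<omega>}
       = (\<integral>\<^sup>+x. emeasure (drive lam p N) {\<omega>. hit N T a \<delta> (Suc n) t q (x ## \<omega>)} \<partial>(D \<Otimes>\<^sub>M P))"
      using E.emeasure_stream_space[of "{\<omega>. hit N T a \<delta> (Suc n) t q \<omega>}"] m[of "Suc n" t q]
      unfolding law dr by (simp add: space_drive del: hit.simps)
    also have "\<dots> = (\<integral>\<^sup>+u. (\<integral>\<^sup>+e. emeasure (drive lam p N) {\<omega>. hit N T a \<delta> (Suc n) t q ((u, e) ## \<omega>)} \<partial>P) \<partial>D)"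
    proof -
      interpret P: prob_space P unfolding P_def by (rule measure_pmf.prob_space_axioms)
      have "{x \<in> space ((D \<Otimes>\<^sub>M P) \<Otimes>\<^sub>M drive lam p N). hit N T a \<delta> (Suc n) t q (fst x ## snd x)} \<in> sets ((D \<Otimes>\<^sub>M P) \<Otimes>\<^sub>M drive lam p N)"
      proof -
        have [measurable_cong]: "sets (D \<Otimes>\<^sub>M P) = sets marks" unfolding law[symmetric] by (rule sets_ev_law)
        have "Measurable.pred ((D \<Otimes>\<^sub>M P) \<Otimes>\<^sub>M drive lam p N) (\<lambda>x. hit N T a \<delta> (Suc n) t q (fst x ## snd x))"
          by (rule measurable_hit) measurable
        then show ?thesis by (simp add: pred_def del: hit.simps)
      qed
      from Dr.measurable_emeasure_Pair[OF this]
      have "(\<lambda>x. emeasure (drive lam p N) {\<omega>. hit N T a \<delta> (Suc n) t q (x ## \<omega>)}) \<in> borel_measurable (D \<Otimes>\<^sub>M P)"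
        by (rule measurable_cong[THEN iffD1, rotated])
           (auto simp: space_pair_measure space_drive vimage_def simp del: hit.simps)
      from P.nn_integral_fst[OF this] show ?thesis by simp
    qed
    also have "\<dots> \<le> (\<integral>\<^sup>+u. (\<integral>\<^sup>+e. indicator {\<delta><..} u + ennreal (hit_bd N T a \<delta> n (t + u) (step N e q)) \<partial>P) \<partial>D)"
    proof (rule nn_integral_mono_AE)
      have "AE u in D. 0 \<le> u"
        unfolding D_def by (subst AE_density) (auto simp: exponential_density_def)
      then show "AE u in D. (\<integral>\<^sup>+e. emeasure (drive lam p N) {\<omega>. hit N T a \<delta> (Suc n) t q ((u, e) ## \<omega>)} \<partial>P)
        \<le> (\<integral>\<^sup>+e. indicator {\<delta><..} u + ennreal (hit_bd N T a \<delta> n (t + u) (step N e q)) \<partial>P)"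
      proof eventually_elim
        case (elim u)
        show ?case
        proof (rule nn_integral_mono)
          fix e
          show "emeasure (drive lam p N) {\<omega>. hit N T a \<delta> (Suc n) t q ((u, e) ## \<omega>)}
             \<le> indicator {\<delta><..} u + ennreal (hit_bd N T a \<delta> n (t + u) (step N e q))"
          \<comment> \<open>A wait longer than \<open>\<delta>\<close> is charged its full
            probability by the indicator; only short waits use the induction hypothesis.\<close>
          proof (cases "\<delta> < u")
            case True
            then show ?thesis using Dr.emeasure_le_1 by (simp add: add_increasing2)
          next
            case False
            then have "{\<omega>. hit N T a \<delta> (Suc n) t q ((u, e) ## \<omega>)} = {\<omega>. hit N T a \<delta> n (t + u) (step N e q) \<omega>}"
              using 3 elim by auto
            then show ?thesis using Suc.IH[of "step N e q" "t + u"] Suc.prems elim by (simp add: add_increasing)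
          qed
        qed
      qed
    qed
    also have "\<dots> \<le> ennreal (hit_bd N T a \<delta> (Suc n) t q)"
      unfolding D_def P_def using hit_bd_step[OF N Suc.prems 3(1) a \<delta>] by (simp add: rate_def)
    finally show ?thesis .
  qed
qed

end

section \<open>Sample paths and convergence\<close>

definition jump_time :: "(real \<times> event) stream \<Rightarrow> nat \<Rightarrow> real" where
  "jump_time \<omega> k = (\<Sum>i<k. fst (\<omega> !! i))"

lemma jump_time_simps [simp]:
  "jump_time \<omega> 0 = 0"
  "jump_time \<omega> (Suc k) = jump_time \<omega> k + fst (\<omega> !! k)"
  by (simp_all add: jump_time_def)

lemma jump_time_stl: "jump_time \<omega> (Suc k) = fst (shd \<omega>) + jump_time (stl \<omega>) k"
  unfolding jump_time_def by (subst sum.lessThan_Suc_shift) simp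

lemma jump_time_mono:
  assumes "\<And>i. 0 \<le> fst (\<omega> !! i)" "j \<le> k"
  shows "jump_time \<omega> j \<le> jump_time \<omega> k"
  unfolding jump_time_def using assms by (intro sum_mono2) auto

lemma njumps_eq: "njumps \<omega> t = card {k. 0 < k \<and> jump_time \<omega> k \<le> t}"
  by (simp add: njumps_def jump_time_def)

lemma run_0 [simp]: "run N q \<omega> 0 = q"
  by (simp add: run_def)

lemma run_Suc: "run N q \<omega> (Suc k) = step N (snd (\<omega> !! k)) (run N q \<omega> k)"
  by (simp add: run_def stake_Suc del: stake.simps)

lemma run_stl: "run N q \<omega> (Suc k) = run N (step N (snd (shd \<omega>)) q) (stl \<omega>) k"
  by (simp add: run_def)

lemma measurable_jump_time [measurable]: "(\<lambda>\<omega>. jump_time \<omega> k) \<in> borel_measurable (stream_space marks)"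
  unfolding jump_time_def by measurable

lemma measurable_run: "(\<lambda>\<omega>. run N q \<omega> k) \<in> stream_space marks \<rightarrow>\<^sub>M count_space UNIV"
proof (induction k)
  case (Suc k)
  note Suc[measurable]
  show ?case unfolding run_Suc by (rule measurable_step) measurable
qed simp

text \<open>The time may depend on the stream, because the state is later evaluated at the jump
  times themselves.\<close>

lemma measurable_Qt:
  assumes [measurable]: "g \<in> borel_measurable (stream_space marks)"
  shows "(\<lambda>\<omega>. Qt N q \<omega> (g \<omega>)) \<in> stream_space marks \<rightarrow>\<^sub>M count_space UNIV"
  unfolding Qt_def
proof (rule measurable_compose_countable[where f="\<lambda>k \<omega>. run N q \<omega> k"])
  show "(\<lambda>\<omega>. njumps \<omega> (g \<omega>)) \<in> stream_space marks \<rightarrow>\<^sub>M count_space UNIV"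
    unfolding njumps_eq by measurable
qed (rule measurable_run)

text \<open>Valid for every stream, including those with negative or accumulating jump times: if only
 finitely many jumps have occurred by t, the state is unchanged slightly before t, otherwise
 \<open>njumps\<close> has the junk value 0 at t and ever after.\<close>

lemma Qt_locally_constant:
  assumes t: "0 < t" "t < T" and nt: "\<And>k. t \<noteq> jump_time \<omega> k" and e: "0 < e"
  obtains s where "s \<in> \<rat>" "0 \<le> s" "s \<le> T" "\<bar>s - t\<bar> < e" "Qt N q \<omega> s = Qt N q \<omega> t"
proof (cases "finite {k. 0 < k \<and> jump_time \<omega> k \<le> t}")
  case True
  define m where "m = Max (insert 0 (insert (t - e) (jump_time \<omega> ` {k. 0 < k \<and> jump_time \<omega> k \<le> t})))"
  have "m \<in> insert 0 (insert (t - e) (jump_time \<omega> ` {k. 0 < k \<and> jump_time \<omega> k \<le> t}))"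
    unfolding m_def by (rule Max_in) (use True in auto)
  then consider "m = 0" | "m = t - e" | k where "m = jump_time \<omega> k" "jump_time \<omega> k \<le> t" by blast
  then have "m < t"
  proof cases
    case (3 k)
    then show ?thesis using nt[of k] by simp
  qed (use t e in simp_all)
  then obtain s where s: "s \<in> \<rat>" "m < s" "s < t" using Rats_dense_in_real by blast
  have m: "0 \<le> m" "t - e \<le> m" "\<And>k. 0 < k \<Longrightarrow> jump_time \<omega> k \<le> t \<Longrightarrow> jump_time \<omega> k \<le> m"
    unfolding m_def by (rule Max_ge; use True in simp)+
  have "{k. 0 < k \<and> jump_time \<omega> k \<le> s} = {k. 0 < k \<and> jump_time \<omega> k \<le> t}"
    using s m by (auto dest: m(3))
  then have "Qt N q \<omega> s = Qt N q \<omega> t" by (simp add: Qt_def njumps_eq)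
  then show thesis using that[of s] s m t by auto
next
  case False
  have "t < min T (t + e)" using t e by simp
  then obtain s where s: "s \<in> \<rat>" "t < s" "s < min T (t + e)" using Rats_dense_in_real by blast
  have "{k. 0 < k \<and> jump_time \<omega> k \<le> t} \<subseteq> {k. 0 < k \<and> jump_time \<omega> k \<le> s}" using s by auto
  then have "infinite {k. 0 < k \<and> jump_time \<omega> k \<le> s}" using False finite_subset by blast
  then have "Qt N q \<omega> s = Qt N q \<omega> t" using False by (simp add: Qt_def njumps_eq)
  then show thesis using that[of s] s t by auto
qed

context fluid
begin

definition exceed :: "nat \<Rightarrow> real \<Rightarrow> real \<Rightarrow> nat list \<Rightarrow> (real \<times> event) stream \<Rightarrow> bool" where
  "exceed N T \<gamma> q \<omega> \<longleftrightarrow> (\<exists>t\<in>{0..T}. \<gamma> < sqrt (gap N (Qt N q \<omega> t) t))"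

text \<open>Reduces uncountably many times to countably many, for measurability. Away from jump
  times the same state is found at rational times arbitrarily near, and for a fixed state
  \<open>gap\<close> is continuous in time, so a strict excess survives there. Jump times and end
  points are kept separately.\<close>

lemma exceed_iff:
  "exceed N T \<gamma> q \<omega> \<longleftrightarrow> (\<exists>t\<in>{0..T} \<inter> (\<rat> \<union> {0, T}). \<gamma> < sqrt (gap N (Qt N q \<omega> t) t))
     \<or> (\<exists>k. jump_time \<omega> k \<in> {0..T} \<and> \<gamma> < sqrt (gap N (Qt N q \<omega> (jump_time \<omega> k)) (jump_time \<omega> k)))"
    (is "_ \<longleftrightarrow> ?R")
proof
  assume "exceed N T \<gamma> q \<omega>"
  then obtain t where t: "0 \<le> t" "t \<le> T" "\<gamma> < sqrt (gap N (Qt N q \<omega> t) t)" by (auto simp: exceed_def)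
  show ?R
  proof (cases "t = 0 \<or> t = T \<or> (\<exists>k. t = jump_time \<omega> k)")
    case True
    then show ?thesis using t by auto
  next
    case False
    have "open ((\<lambda>s. sqrt (gap N (Qt N q \<omega> t) s)) -` {\<gamma><..})"
      by (intro open_vimage continuous_intros gap_continuous)
    then obtain e where e: "0 < e" "\<And>s. \<bar>s - t\<bar> < e \<Longrightarrow> \<gamma> < sqrt (gap N (Qt N q \<omega> t) s)"
      using t(3) unfolding open_dist by (auto simp: dist_real_def)
    obtain s where "s \<in> \<rat>" "0 \<le> s" "s \<le> T" "\<bar>s - t\<bar> < e" "Qt N q \<omega> s = Qt N q \<omega> t"
      by (rule Qt_locally_constant[of t T \<omega> e N q]) (use False t e in \<open>simp_all add: less_le\<close>)
    then show ?thesis using e(2)[of s] by (intro disjI1 bexI[of _ s]) auto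
  qed
qed (auto simp: exceed_def)

lemma measurable_exceed: "Measurable.pred (drive lam p N) (exceed N T \<gamma> q)"
proof -
  have Q: "(\<lambda>\<omega>. gap N (Qt N q \<omega> (g \<omega>)) (g \<omega>)) \<in> borel_measurable (stream_space marks)"
    if "g \<in> borel_measurable (stream_space marks)" for g
    by (rule measurable_gap[OF measurable_Qt[OF that] that])
  have [measurable]: "(\<lambda>\<omega>. gap N (Qt N q \<omega> t) t) \<in> borel_measurable (stream_space marks)" for t
    by (rule Q) simp
  have [measurable]: "(\<lambda>\<omega>. gap N (Qt N q \<omega> (jump_time \<omega> k)) (jump_time \<omega> k)) \<in> borel_measurable (stream_space marks)" for k
    by (rule Q) simp
  have c: "countable ({0..T} \<inter> (\<rat> \<union> {0, T}))" using countable_rat by auto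
  have "Measurable.pred (stream_space marks) (\<lambda>\<omega>. \<exists>t\<in>{0..T} \<inter> (\<rat> \<union> {0, T}). \<gamma> < sqrt (gap N (Qt N q \<omega> t) t))"
  proof -
    have "{\<omega> \<in> space (stream_space marks). \<exists>t\<in>{0..T} \<inter> (\<rat> \<union> {0, T}). \<gamma> < sqrt (gap N (Qt N q \<omega> t) t)}
      = (\<Union>t\<in>{0..T} \<inter> (\<rat> \<union> {0, T}). {\<omega> \<in> space (stream_space marks). \<gamma> < sqrt (gap N (Qt N q \<omega> t) t)})"
      by blast
    also have "\<dots> \<in> sets (stream_space marks)"
      by (rule sets.countable_UN''[OF c]) measurable
    finally show ?thesis by (simp add: pred_def)
  qed
  then have "Measurable.pred (stream_space marks) (exceed N T \<gamma> q)"
    unfolding exceed_iff[abs_def] by measurable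
  then show ?thesis by (simp cong: measurable_cong_sets[OF sets_drive refl])
qed

text \<open>Unfolds the recursion into a statement about the path: up to an event beyond T all waits
  are short and the state is near the fluid path at each jump.\<close>

lemma not_hit_path:
  assumes "\<not> hit N T a \<delta> n t q \<omega>" "\<And>i. 0 \<le> fst (\<omega> !! i)"
  shows "\<exists>K. T < t + jump_time \<omega> K \<and> (\<forall>k<K. fst (\<omega> !! k) \<le> \<delta>
     \<and> exp (- (15 * (t + jump_time \<omega> k))) * gap N (run N q \<omega> k) (t + jump_time \<omega> k) < a)"
  using assms
proof (induction n arbitrary: t q \<omega>)
  case 0
  then show ?case by (intro exI[of _ 0]) auto
next
  case (Suc n)
  show ?case
  proof (cases "T < t")
    case True
    then show ?thesis by (intro exI[of _ 0]) auto
  next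
    case False
    then have good: "exp (- (15 * t)) * gap N q t < a" "fst (shd \<omega>) \<le> \<delta>"
      and nh: "\<not> hit N T a \<delta> n (t + fst (shd \<omega>)) (step N (snd (shd \<omega>)) q) (stl \<omega>)"
      using Suc.prems(1) by auto
    have "0 \<le> fst (stl \<omega> !! i)" for i using Suc.prems(2)[of "Suc i"] by simp
    from Suc.IH[OF nh this] obtain K where K: "T < t + fst (shd \<omega>) + jump_time (stl \<omega>) K"
      "\<And>k. k < K \<Longrightarrow> fst (stl \<omega> !! k) \<le> \<delta> \<and> exp (- (15 * (t + fst (shd \<omega>) + jump_time (stl \<omega>) k)))
         * gap N (run N (step N (snd (shd \<omega>)) q) (stl \<omega>) k) (t + fst (shd \<omega>) + jump_time (stl \<omega>) k) < a"
      by blast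
    show ?thesis
    proof (intro exI[of _ "Suc K"] conjI allI impI)
      show "T < t + jump_time \<omega> (Suc K)" using K(1) unfolding jump_time_stl by (simp add: add.assoc)
      fix k assume k: "k < Suc K"
      show "fst (\<omega> !! k) \<le> \<delta>" using k good K(2)[of "k - 1"] by (cases k) auto
      show "exp (- (15 * (t + jump_time \<omega> k))) * gap N (run N q \<omega> k) (t + jump_time \<omega> k) < a"
      proof (cases k)
        case 0
        then show ?thesis using good by simp
      next
        case (Suc j)
        then show ?thesis using K(2)[of j] k unfolding Suc jump_time_stl run_stl by (simp add: add.assoc)
      qed
    qed
  qed
qed

text \<open>Carries the bound from a jump time to the following wait, by (x + y)^2 <= 2 x^2 + 2 y^2;
  the 4 is this 2 times the total weight 2.\<close>

lemma gap_shift: "gap N q s \<le> 2 * gap N q t + 4 * (L * (s - t))\<^sup>2"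
proof -
  have b: "Bseq (\<lambda>i. (Vvec N q i - v t i)\<^sup>2)" for t by (intro Bseqs)
  have "gap N q s \<le> wsum (\<lambda>i. 2 * (Vvec N q i - v t i)\<^sup>2 + 2 * (L * (s - t))\<^sup>2)"
    unfolding gap_def
  proof (rule wsum_mono)
    fix i
    have "(Vvec N q i - v s i)\<^sup>2 = ((Vvec N q i - v t i) + (v t i - v s i))\<^sup>2" by simp
    also have "\<dots> \<le> 2 * (Vvec N q i - v t i)\<^sup>2 + 2 * (v t i - v s i)\<^sup>2"
    proof -
      have "2 * x\<^sup>2 + 2 * y\<^sup>2 - (x + y)\<^sup>2 = (x - y)\<^sup>2" for x y :: real
        by (simp add: power2_eq_square algebra_simps)
      then show ?thesis by (metis diff_ge_0_iff_ge zero_le_power2)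
    qed
    also have "(v t i - v s i)\<^sup>2 \<le> (L * (s - t))\<^sup>2"
      using v_lip[of t i s] L_nonneg by (subst abs_le_square_iff[symmetric]) (simp add: abs_mult abs_minus_commute)
    finally show "(Vvec N q i - v s i)\<^sup>2 \<le> 2 * (Vvec N q i - v t i)\<^sup>2 + 2 * (L * (s - t))\<^sup>2" by simp
  qed (intro Bseqs)+
  also have "\<dots> = 2 * gap N q t + 4 * (L * (s - t))\<^sup>2"
    by (subst wsum_add) (auto intro!: Bseqs simp: wsum_const wsum_cmult b gap_def)
  finally show ?thesis .
qed

text \<open>With \<open>wait\<close> below, \<open>gap_shift\<close> gives at most 2 (\<gamma>^2 /
  4) + 4 (\<gamma> / 4)^2 = 3 \<gamma>^2 / 4 between jumps, still below \<gamma>^2. The exponential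
  undoes the discount at its worst, at time T, and \<open>L + 1\<close> in \<open>wait\<close>
  avoids division by zero.\<close>

definition level :: "real \<Rightarrow> real \<Rightarrow> real" where "level T \<gamma> = \<gamma>\<^sup>2 * exp (- (15 * T)) / 4"
definition wait :: "real \<Rightarrow> real" where "wait \<gamma> = \<gamma> / (4 * (L + 1))"

lemma not_hit_not_exceed:
  assumes nh: "\<not> hit N T (level T \<gamma>) (wait \<gamma>) n 0 q \<omega>" and nonneg: "\<And>i. 0 \<le> fst (\<omega> !! i)" and \<gamma>: "0 < \<gamma>"
  shows "\<not> exceed N T \<gamma> q \<omega>"
proof
  assume "exceed N T \<gamma> q \<omega>"
  then obtain s where s: "0 \<le> s" "s \<le> T" "\<gamma> < sqrt (gap N (Qt N q \<omega> s) s)" by (auto simp: exceed_def)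
  obtain K where K: "T < jump_time \<omega> K"
    "\<And>k. k < K \<Longrightarrow> fst (\<omega> !! k) \<le> wait \<gamma>"
    "\<And>k. k < K \<Longrightarrow> exp (- (15 * jump_time \<omega> k)) * gap N (run N q \<omega> k) (jump_time \<omega> k) < level T \<gamma>"
    using not_hit_path[OF nh nonneg] by auto
  have ltK: "k < K" if "jump_time \<omega> k \<le> s" for k
    using jump_time_mono[OF nonneg, of K k] K(1) s(2) that by (meson leI not_le order_trans)
  define m where "m = Max {k. jump_time \<omega> k \<le> s}"
  have fin: "finite {k. jump_time \<omega> k \<le> s}" by (rule finite_subset[of _ "{..<K}"]) (auto dest: ltK)
  then have "m \<in> {k. jump_time \<omega> k \<le> s}" unfolding m_def using s by (intro Max_in) (auto intro: exI[of _ 0])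
  then have m: "jump_time \<omega> m \<le> s" by simp
  have gt: "s < jump_time \<omega> (Suc m)"
    using Max_ge[OF fin, of "Suc m"] unfolding m_def[symmetric] mem_Collect_eq by (meson Suc_n_not_le_n not_le)
  \<comment> \<open>The index 0 belongs to the start, not to a jump, so the count of jumps is
    exactly m, the index of the last jump before s.\<close>
  have "{k. 0 < k \<and> jump_time \<omega> k \<le> s} = {1..m}"
  proof (intro equalityI subsetI)
    fix k assume "k \<in> {k. 0 < k \<and> jump_time \<omega> k \<le> s}"
    then show "k \<in> {1..m}" using Max_ge[OF fin, of k] by (auto simp: m_def)
  next
    fix k assume "k \<in> {1..m}"
    then show "k \<in> {k. 0 < k \<and> jump_time \<omega> k \<le> s}" using jump_time_mono[OF nonneg, of k m] m by auto
  qed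
  then have Q: "Qt N q \<omega> s = run N q \<omega> m" by (simp add: Qt_def njumps_eq)
  let ?g = "gap N (run N q \<omega> m) (jump_time \<omega> m)"
  have "exp (- (15 * T)) * ?g \<le> exp (- (15 * jump_time \<omega> m)) * ?g"
    using m s gap_nonneg by (intro mult_right_mono) auto
  also have "\<dots> < level T \<gamma>" using K(3)[OF ltK[OF m]] .
  finally have g: "?g < \<gamma>\<^sup>2 / 4" by (simp add: level_def)
  have "\<bar>L * (s - jump_time \<omega> m)\<bar> \<le> L * wait \<gamma>"
    using gt m K(2)[OF ltK[OF m]] L_nonneg by (auto simp: abs_mult intro!: mult_left_mono)
  also have "\<dots> \<le> \<gamma> / 4" using L_nonneg \<gamma> by (simp add: wait_def field_simps)
  finally have "(L * (s - jump_time \<omega> m))\<^sup>2 \<le> (\<gamma> / 4)\<^sup>2"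
    using \<gamma> by (subst abs_le_square_iff[symmetric]) simp
  then have "gap N (run N q \<omega> m) s < \<gamma>\<^sup>2"
    using gap_shift[of N "run N q \<omega> m" s "jump_time \<omega> m"] g \<gamma> by (simp add: power_divide) (smt (verit) zero_less_power)
  then have "sqrt (gap N (Qt N q \<omega> s) s) < \<gamma>"
    unfolding Q using \<gamma> real_sqrt_less_mono by fastforce
  with s(3) show False by simp
qed

text \<open>The set on the left is free of the number n of allowed events, so n may tend to infinity
  in the bound, which removes the Chernoff term.\<close>

lemma emeasure_exceed_le:
  assumes N: "1 \<le> N" and len: "length q = N" and \<gamma>: "0 < \<gamma>"
  shows "emeasure (drive lam p N) {\<omega>. exceed N T \<gamma> q \<omega>}
     \<le> ennreal (gap N q 0 / level T \<gamma> + cost T (level T \<gamma>) (wait \<gamma>) / (real N * level T \<gamma>))"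
proof -
  interpret E: prob_space "ev_law lam p N" by (rule prob_space_ev_law[OF lam(1) N])
  let ?a = "level T \<gamma>" and ?d = "wait \<gamma>"
  have a: "0 < ?a" "0 < ?d" using \<gamma> L_nonneg by (auto simp: level_def wait_def)
  have pos: "AE \<omega> in drive lam p N. \<forall>i. 0 \<le> fst (\<omega> !! i)"
  proof -
    let ?D = "density lborel (\<lambda>x. ennreal (exponential_density (real N * (lam + 1)) x))"
    have D: "AE u in ?D. 0 \<le> u" by (subst AE_density) (auto simp: exponential_density_def)
    interpret P: pair_sigma_finite ?D "measure_pmf (ev_pmf lam p N)" 
      by (intro pair_sigma_finite.intro prob_space_imp_sigma_finite prob_space_exponential_density measure_pmf.prob_space_axioms)
         (use N lam in auto)
    have "AE x in ev_law lam p N. 0 \<le> fst x"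
    proof (rule P.AE_pair_measure)
      show "{x \<in> space (ev_law lam p N). 0 \<le> fst x} \<in> sets (ev_law lam p N)" by measurable
      show "AE x in ?D. AE y in measure_pmf (ev_pmf lam p N). 0 \<le> fst (x, y)" using D by simp
    qed
    then have "AE \<omega> in drive lam p N. stream_all (\<lambda>x. 0 \<le> fst x) \<omega>"
      unfolding drive_def by (intro E.AE_stream_all) measurable
    then show ?thesis by (auto simp: stream_all_def)
  qed
  have bd: "emeasure (drive lam p N) {\<omega>. exceed N T \<gamma> q \<omega>} \<le> ennreal (hit_bd N T ?a ?d n 0 q)" for n
  proof -
    have "emeasure (drive lam p N) {\<omega>. exceed N T \<gamma> q \<omega>} \<le> emeasure (drive lam p N) {\<omega>. hit N T ?a ?d n 0 q \<omega>}"
    proof (rule emeasure_mono_AE)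
      show "AE \<omega> in drive lam p N. \<omega> \<in> {\<omega>. exceed N T \<gamma> q \<omega>} \<longrightarrow> \<omega> \<in> {\<omega>. hit N T ?a ?d n 0 q \<omega>}"
        using pos by eventually_elim (use not_hit_not_exceed[OF _ _ \<gamma>] in blast)
      have "Measurable.pred (drive lam p N) (\<lambda>\<omega>. hit N T ?a ?d n 0 q \<omega>)"
        by (rule measurable_hit) (simp_all add: measurable_ident_sets[OF sets_drive])
      then show "{\<omega>. hit N T ?a ?d n 0 q \<omega>} \<in> sets (drive lam p N)" by (simp add: pred_def space_drive)
    qed
    also have "\<dots> \<le> ennreal (hit_bd N T ?a ?d n 0 q)"
      by (rule emeasure_hit_le[OF N len order_refl a])
    finally show ?thesis .
  qed
  have "norm (rate N / (rate N + 1)) < 1" using rate[OF N] by simp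
  then have "(\<lambda>n. hit_bd N T ?a ?d n 0 q) \<longlonglongrightarrow> 1 / ?a * (exp (- (15 * 0)) * gap N q 0)
     + (cost T ?a ?d / (real N * ?a) + exp T * 0) * exp (- 0)"
    unfolding hit_bd_def by (intro tendsto_intros)
  then have "(\<lambda>n. hit_bd N T ?a ?d n 0 q) \<longlonglongrightarrow> gap N q 0 / ?a + cost T ?a ?d / (real N * ?a)" by simp
  then have "(\<lambda>n. ennreal (hit_bd N T ?a ?d n 0 q)) \<longlonglongrightarrow> ennreal (gap N q 0 / ?a + cost T ?a ?d / (real N * ?a))"
    by (rule tendsto_ennrealI)
  then show ?thesis by (rule LIMSEQ_le_const) (use bd in auto)
qed

lemma exceed_in_sets: "{(q, \<omega>). exceed N T \<gamma> q \<omega>} \<in> sets (sysM lam p N \<mu>)"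
proof -
  have "Measurable.pred (measure_pmf \<mu> \<Otimes>\<^sub>M drive lam p N) (\<lambda>x. exceed N T \<gamma> (fst x) (snd x))"
  proof (rule measurable_compose_countable[where f="\<lambda>q x. exceed N T \<gamma> q (snd x)" and g=fst])
    show "Measurable.pred (measure_pmf \<mu> \<Otimes>\<^sub>M drive lam p N) (\<lambda>x. exceed N T \<gamma> q (snd x))" for q
      by (rule measurable_compose[OF measurable_snd measurable_exceed])
    show "fst \<in> measure_pmf \<mu> \<Otimes>\<^sub>M drive lam p N \<rightarrow>\<^sub>M count_space UNIV"
      using measurable_fst[of "measure_pmf \<mu>" "drive lam p N"] by (simp cong: measurable_cong_sets)
  qed
  then show ?thesis
    by (simp add: pred_def sysM_def space_pair_measure space_drive case_prod_beta')
qed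

text \<open>Initial states farther than \<open>\<eta>\<close> from the fluid path are charged their
  full probability; the others enter through \<open>\<eta>^2 / level\<close>.\<close>

lemma measure_exceed_le:
  assumes N: "1 \<le> N" and len: "\<And>q. q \<in> set_pmf \<mu> \<Longrightarrow> length q = N" and \<gamma>: "0 < \<gamma>" and \<eta>: "0 < \<eta>"
  shows "measure (sysM lam p N \<mu>) {(q, \<omega>). exceed N T \<gamma> q \<omega>} \<le> measure_pmf.prob \<mu> {q. \<eta> < sqrt (gap N q 0)}
     + (\<eta>\<^sup>2 / level T \<gamma> + cost T (level T \<gamma>) (wait \<gamma>) / (real N * level T \<gamma>))"
proof -
  interpret E: prob_space "ev_law lam p N" by (rule prob_space_ev_law[OF lam(1) N])
  interpret Dr: prob_space "drive lam p N" unfolding drive_def by (rule E.prob_space_stream_space)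
  let ?a = "level T \<gamma>"
  let ?c = "\<eta>\<^sup>2 / ?a + cost T ?a (wait \<gamma>) / (real N * ?a)"
  let ?B = "{q. \<eta> < sqrt (gap N q 0)}"
  have a: "0 < ?a" using \<gamma> by (simp add: level_def)
  have c: "0 \<le> ?c" using a by (simp add: cost_def)
  have "emeasure (sysM lam p N \<mu>) {(q, \<omega>). exceed N T \<gamma> q \<omega>}
     = (\<integral>\<^sup>+q. emeasure (drive lam p N) {\<omega>. exceed N T \<gamma> q \<omega>} \<partial>measure_pmf \<mu>)"
    using Dr.emeasure_pair_measure_alt[OF exceed_in_sets[unfolded sysM_def, of N T \<gamma> \<mu>]] unfolding sysM_def
    by (simp add: vimage_def)
  also have "\<dots> \<le> (\<integral>\<^sup>+q. indicator ?B q + ennreal ?c \<partial>measure_pmf \<mu>)"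
  proof (rule nn_integral_mono_AE, rule AE_pmfI)
    fix q assume q: "q \<in> set_pmf \<mu>"
    show "emeasure (drive lam p N) {\<omega>. exceed N T \<gamma> q \<omega>} \<le> indicator ?B q + ennreal ?c"
    proof (cases "q \<in> ?B")
      case True
      then show ?thesis using Dr.emeasure_le_1 by (simp add: add_increasing2)
    next
      case False
      then have "gap N q 0 \<le> \<eta>\<^sup>2" using \<eta> by (simp add: not_less real_le_lsqrt real_sqrt_le_iff' sqrt_le_D)
      then have "gap N q 0 / ?a \<le> \<eta>\<^sup>2 / ?a" using a by (simp add: divide_right_mono)
      then have "ennreal (gap N q 0 / ?a + cost T ?a (wait \<gamma>) / (real N * ?a)) \<le> ennreal ?c"
        by (intro ennreal_leI) simp
      with emeasure_exceed_le[OF N len[OF q] \<gamma>, of T]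
      have "emeasure (drive lam p N) {\<omega>. exceed N T \<gamma> q \<omega>} \<le> ennreal ?c" by (rule order_trans)
      then show ?thesis using False by simp
    qed
  qed
  also have "\<dots> = emeasure (measure_pmf \<mu>) ?B + ennreal ?c"
    by (simp add: nn_integral_add measure_pmf.emeasure_space_1)
  also have "\<dots> = ennreal (measure_pmf.prob \<mu> ?B + ?c)"
    using c by (simp add: measure_pmf.emeasure_eq_measure)
  finally show ?thesis
    unfolding measure_def using c by (intro enn2real_leI) auto
qed

end

theorem theorem4:
  fixes lam p T :: real
    and init :: "nat \<Rightarrow> nat list pmf"
    and v0 :: "nat \<Rightarrow> real"
    and v :: "real \<Rightarrow> nat \<Rightarrow> real"
  assumes "0 \<le> lam" "lam < 1" "0 \<le> p" "p \<le> 1" "0 < T"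
    and "\<And>N q. 1 \<le> N \<Longrightarrow> q \<in> set_pmf (init N) \<Longrightarrow> length q = N"
    and "v0 \<in> Vbar"
    and "\<And>\<gamma>. \<gamma> > 0 \<Longrightarrow>
           (\<lambda>N. measure_pmf.prob (init N) {q. wnorm (\<lambda>i. Vvec N q i - v0 i) > \<gamma>})
             \<longlonglongrightarrow> 0"
    and "fluid_solution lam p v0 v"
  shows "\<forall>\<gamma>>0.
     (\<forall>N\<ge>1. {(q0, \<omega>). (\<Squnion>t\<in>{0..T}. ereal (wnorm (\<lambda>i. Vvec N (Qt N q0 \<omega> t) i - v t i)))
                        > ereal \<gamma>} \<in> sets (sysM lam p N (init N)))
   \<and> (\<lambda>N. measure (sysM lam p N (init N))
          {(q0, \<omega>). (\<Squnion>t\<in>{0..T}. ereal (wnorm (\<lambda>i. Vvec N (Qt N q0 \<omega> t) i - v t i)))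
                        > ereal \<gamma>}) \<longlonglongrightarrow> 0"
proof (intro allI impI)
  fix \<gamma> :: real assume \<gamma>: "0 < \<gamma>"
  note sol = assms(9)[unfolded fluid_solution_def]
  obtain L where L: "\<And>i. L-lipschitz_on {0..} (\<lambda>t. v t i)" using sol by blast
  obtain Z where Z: "Z \<in> null_sets lborel" "\<And>t. t \<notin> Z \<Longrightarrow> 0 < t \<Longrightarrow> \<forall>i\<ge>1. ((\<lambda>s. v s i) has_real_derivative
      (lam * (v t (i - 1) - v t i) - (1 - p) * (v t i - v t (i + 1)) - gfl lam p (v t) i)) (at t)"
  proof -
    have "AE t in lborel. 0 < t \<longrightarrow> (\<forall>i\<ge>1. ((\<lambda>s. v s i) has_real_derivative
      (lam * (v t (i - 1) - v t i) - (1 - p) * (v t i - v t (i + 1)) - gfl lam p (v t) i)) (at t))"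
      using sol by blast
    then obtain Z where "Z \<in> null_sets lborel" "{t \<in> space lborel. \<not> (0 < t \<longrightarrow> (\<forall>i\<ge>1. ((\<lambda>s. v s i) has_real_derivative
      (lam * (v t (i - 1) - v t i) - (1 - p) * (v t i - v t (i + 1)) - gfl lam p (v t) i)) (at t)))} \<subseteq> Z"
      unfolding eventually_ae_filter by blast
    then show thesis by (intro that[of Z]) auto
  qed
  \<comment> \<open>Constant continuation to negative times, where nothing is known about
    \<open>v\<close>; it keeps the Lipschitz constant, and near any positive time it equals
    \<open>v\<close>.\<close>
  define w where "w t = v (max 0 t)" for t :: real
  have wV: "0 \<le> w t i" "w t i \<le> w t 0" for t i
  proof -
    have "w t \<in> Vbar" unfolding w_def using sol by simp
    then obtain s where s: "s \<in> Sbar" "\<And>i. w t i = (\<Sum>j. s (i + j))" unfolding Vbar_def by blast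
    have sm: "summable s" using s(1) summable_Suc_iff[of s] by (simp add: Sbar_def)
    have nn: "0 \<le> s i" for i using s(1) by (simp add: Sbar_def)
    have "w t 0 = (\<Sum>j. s (j + i)) + sum s {..<i}"
      using suminf_split_initial_segment[OF sm, of i] s(2)[of 0] by simp
    then show "w t i \<le> w t 0" using s(2)[of i] nn by (simp add: add.commute sum_nonneg)
    have "summable (\<lambda>j. s (i + j))" using sm by (subst add.commute) (rule summable_ignore_initial_segment)
    then show "0 \<le> w t i" unfolding s(2) by (rule suminf_nonneg) (rule nn)
  qed
  interpret fluid lam p L w Z
  proof
    show "w t 0 = 1 + w t 1" for t
    proof -
      have "v (max 0 t) 0 - v (max 0 t) 1 = 1" using sol by simp
      then show ?thesis by (simp add: w_def)
    qed
    show "\<bar>w t i - w s i\<bar> \<le> L * \<bar>t - s\<bar>" for t s i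
    proof -
      have "0 \<le> L" using L[of 0] by (rule lipschitz_on_nonneg)
      moreover have "\<bar>w t i - w s i\<bar> \<le> L * \<bar>max 0 t - max 0 s\<bar>"
        using lipschitz_onD[OF L[of i], of "max 0 t" "max 0 s"] by (simp add: w_def dist_real_def)
      moreover have "\<bar>max 0 t - max 0 s\<bar> \<le> \<bar>t - s\<bar>" by linarith
      ultimately show ?thesis using mult_left_mono by fastforce
    qed
    show "negligible Z" using Z(1) null_sets_completionI by (simp add: negligible_iff_null_sets)
    show "((\<lambda>s. w s i) has_real_derivative
        (lam * (w t (i - 1) - w t i) - (1 - p) * (w t i - w t (i + 1)) - gfl lam p (w t) i)) (at t)"
      if t: "0 < t" "t \<notin> Z" "1 \<le> i" for t i
    proof -
      have "((\<lambda>s. v s i) has_real_derivative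
        (lam * (w t (i - 1) - w t i) - (1 - p) * (w t i - w t (i + 1)) - gfl lam p (w t) i)) (at t)"
        using Z(2)[OF t(2,1)] t by (simp add: w_def max_def)
      then show ?thesis
        by (rule has_field_derivative_transform_within[where d=t]) (use t in \<open>auto simp: w_def dist_real_def\<close>)
    qed
  qed (use assms wV in auto)
  have wn: "wnorm (\<lambda>i. Vvec N q i - v t i) = sqrt (gap N q t)" if "0 \<le> t" for N q t
    using that by (simp add: wnorm_def gap_def wsum_def w_def max_def)
  have v0: "v 0 = v0" using sol by simp
  \<comment> \<open>In the extended reals a supremum strictly exceeds \<gamma> exactly if some
    member does, so no boundedness of the path is involved.\<close>
  have ev: "{(q0, \<omega>). (\<Squnion>t\<in>{0..T}. ereal (wnorm (\<lambda>i. Vvec N (Qt N q0 \<omega> t) i - v t i))) > ereal \<gamma>}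
     = {(q0, \<omega>). exceed N T \<gamma> q0 \<omega>}" for N
    by (auto simp: less_SUP_iff exceed_def wn)
  let ?a = "level T \<gamma>"
  let ?P = "\<lambda>\<eta> N. measure_pmf.prob (init N) {q. \<eta> < sqrt (gap N q 0)}"
  have a: "0 < ?a" using \<gamma> by (simp add: level_def)
  have P: "?P \<eta> \<longlonglongrightarrow> 0" if "0 < \<eta>" for \<eta>
    using assms(8)[OF that] unfolding v0[symmetric] wn[OF order_refl] .
  have "(\<lambda>N. measure (sysM lam p N (init N)) {(q0, \<omega>). exceed N T \<gamma> q0 \<omega>}) \<longlonglongrightarrow> 0"
  proof (rule order_tendstoI)
    fix \<epsilon> :: real assume \<epsilon>: "0 < \<epsilon>"
    \<comment> \<open>Chosen so that the initial states near \<open>v0\<close> contribute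
      \<open>\<epsilon> / 2\<close>; the other terms tend to 0 with N.\<close>
    define \<eta> where "\<eta> = sqrt (?a * \<epsilon> / 2)"
    have \<eta>: "0 < \<eta>" "\<eta>\<^sup>2 / ?a = \<epsilon> / 2" using a \<epsilon> by (auto simp: \<eta>_def)
    have "(\<lambda>N. cost T ?a (wait \<gamma>) / ?a * (1 / real N)) \<longlonglongrightarrow> cost T ?a (wait \<gamma>) / ?a * 0"
      by (intro tendsto_intros lim_1_over_n)
    then have "(\<lambda>N. ?P \<eta> N + (\<eta>\<^sup>2 / ?a + cost T ?a (wait \<gamma>) / ?a * (1 / real N)))
       \<longlonglongrightarrow> 0 + (\<eta>\<^sup>2 / ?a + cost T ?a (wait \<gamma>) / ?a * 0)"
      by (intro tendsto_add P \<eta> tendsto_const)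
    moreover have "0 + (\<eta>\<^sup>2 / ?a + cost T ?a (wait \<gamma>) / ?a * 0) < \<epsilon>" using \<eta> \<epsilon> by simp
    ultimately have "\<forall>\<^sub>F N in sequentially. ?P \<eta> N + (\<eta>\<^sup>2 / ?a + cost T ?a (wait \<gamma>) / ?a * (1 / real N)) < \<epsilon>"
      by (rule order_tendstoD(2))
    then show "\<forall>\<^sub>F N in sequentially. measure (sysM lam p N (init N)) {(q0, \<omega>). exceed N T \<gamma> q0 \<omega>} < \<epsilon>"
      using eventually_ge_at_top[of 1]
    proof eventually_elim
      case (elim N)
      have "measure (sysM lam p N (init N)) {(q0, \<omega>). exceed N T \<gamma> q0 \<omega>}
         \<le> ?P \<eta> N + (\<eta>\<^sup>2 / ?a + cost T ?a (wait \<gamma>) / (real N * ?a))"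
        by (rule measure_exceed_le) (use elim assms(6) \<gamma> \<eta> in auto)
      then show ?case using elim by (simp add: mult.commute)
    qed
  qed (auto intro!: always_eventually less_le_trans[OF _ measure_nonneg])
  then show "(\<forall>N\<ge>1. {(q0, \<omega>). (\<Squnion>t\<in>{0..T}. ereal (wnorm (\<lambda>i. Vvec N (Qt N q0 \<omega> t) i - v t i)))
                        > ereal \<gamma>} \<in> sets (sysM lam p N (init N)))
   \<and> (\<lambda>N. measure (sysM lam p N (init N))
          {(q0, \<omega>). (\<Squnion>t\<in>{0..T}. ereal (wnorm (\<lambda>i. Vvec N (Qt N q0 \<omega> t) i - v t i)))
                        > ereal \<gamma>}) \<longlonglongrightarrow> 0"
    unfolding ev using exceed_in_sets by blast
qed

end
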